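(* Let $\varepsilon>0$, let $\omega\subset\mathbb R^2$ be a bounded simply connected domain and let $u=u_\varepsilon$ be a critical point of $E_\varepsilon$ in $\omega$, continuous on $\overline\omega$ and satisfying $\mathrm{dist}(u(x),\Gamma)\le\delta_1$ for all $x\in\overline\omega$. Let $t,\varphi$ be the coordinates associated with $u$, i.e. continuous real functions on $\overline\omega$ with $|t|\le\delta_1$ and $$u(x)=\tau\left(e^{\imath\varphi(x)}\right)+t(x)\,\vec n\left(\tau\left(e^{\imath\varphi(x)}\right)\right).$$ Then $$\min_{\overline\omega}\left(\varphi-\frac{mt^2}2\right)=\min_{\partial\omega}\left(\varphi-\frac{mt^2}2\right),\qquad \max_{\overline\omega}\left(\varphi+\frac{mt^2}2\right)=\max_{\partial\omega}\left(\varphi+\frac{mt^2}2\right).$$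
   Context: Standing assumptions on $\Gamma$, $\tau$, $W$: $\Gamma\subset\mathbb R^2$ is a smooth simple closed curve of length $2\pi$; $\tau:\mathbb S^1\to\Gamma$ is an arc length parametrization of $\Gamma$; $W:\mathbb R^2\to[0,\infty)$ is a smooth function with $W^{-1}(\{0\})=\Gamma$; $W$ is non-degenerate: there are $\mu,\delta>0$ with $W(\zeta)\ge\mu\,\mathrm{dist}^2(\zeta,\Gamma)$ whenever $\mathrm{dist}(\zeta,\Gamma)<\delta$; and there is $R_0>\max\{|z|:z\in\Gamma\}$ such that the radial derivative satisfies $\frac{\partial W}{\partial r}(z)\ge0$ for $|z|=r>R_0$. Energy: $E_\varepsilon(u)=\int\left[\frac12|\nabla u|^2+\frac{W(u)}{\varepsilon^2}\right]$; a critical point in $\omega$ is a solution $u:\omega\to\mathbb R^2$ of $\Delta u=\frac1{\varepsilon^2}\nabla W(u)$ in $\omega$. Coordinates near $\Gamma$: fix $\delta_\Gamma>0$ so small that the nearest point projection $\Pi$ onto $\Gamma$ is well-defined and smooth in $\{z:\mathrm{dist}(z,\Gamma)<\delta_\Gamma\}$. Let $\vec n(z)$ be the inward unit normal and $\kappa(z)$ the curvature of $\Gamma$ at $z\in\Gamma$ (signed with respect to $\vec n$). A map $u$ with values in this neighborhood is written $u=\tau(e^{\imath\varphi})+t\,\vec n(\tau(e^{\imath\varphi}))$, where $t\in(-\delta_\Gamma,\delta_\Gamma)$ is the signed distance of $u$ to $\Gamma$ (positive inside $\Gamma$) and $\varphi$ is a real phase, defined mod $2\pi$. In these coordinates $|\nabla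 u|^2=(1-t\kappa(\tau(e^{\imath\varphi})))^2|\nabla\varphi|^2+|\nabla t|^2$ and $W(u)=\alpha(\varphi,t)t^2$ with $\alpha$ smooth, positive and $2\pi$-periodic in $\varphi$. Set $a(\varphi,t)=(1-t\kappa(\tau(e^{\imath\varphi})))^2$, $b=-\frac12a_\varphi$, $c=-\frac12a_t$ (subscripts denote partial derivatives). Constants: fix $\delta_0\in(0,\delta_\Gamma)$ (sufficiently small) and positive constants $c_0,\dots,c_5$ such that for $|t|\le\delta_0$ and all $\varphi$: $|1-a|\le c_0|t|$, $2\alpha-|\alpha_tt|\ge c_1$, $|c|\le c_2$, $|b/a|\le c_3|t|$, $|a_t/a|\le2c_4$, $|\alpha_\varphi/a|\le c_5$. Then fix $m>0$ and $0<\delta_1<\delta_0$ with $\frac{c_5}{c_1}\le m$ and $2c_4\delta_1+m(mc_2+c_3)\delta_1^3<1$. *)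

theory Defs
  imports "HOL-Analysis.Analysis"
begin

text \<open>
  The plane is identified with \<^typ>\<open>complex\<close>, whose norm and inner product are the Euclidean ones.
\<close>

section \<open>Differential calculus\<close>

text \<open>Only meant for open \<open>S\<close>; for such \<open>S\<close> this is the usual class of \<open>C\<^sup>k\<close> functions.\<close>

fun Ck_on :: "nat \<Rightarrow> 'a::real_normed_vector set \<Rightarrow> ('a \<Rightarrow> 'b::real_normed_vector) \<Rightarrow> bool" where
  "Ck_on 0 S f \<longleftrightarrow> continuous_on S f"
| "Ck_on (Suc k) S f \<longleftrightarrow>
     (\<forall>x\<in>S. f differentiable (at x)) \<and> (\<forall>v. Ck_on k S (\<lambda>x. frechet_derivative f (at x) v))"

definition smooth_on :: "'a::real_normed_vector set \<Rightarrow> ('a \<Rightarrow> 'b::real_normed_vector) \<Rightarrow> bool" where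
  "smooth_on S f \<longleftrightarrow> (\<forall>k. Ck_on k S f)"

definition gradient :: "('a::euclidean_space \<Rightarrow> real) \<Rightarrow> 'a \<Rightarrow> 'a" where
  "gradient f x = (\<Sum>i\<in>Basis. frechet_derivative f (at x) i *\<^sub>R i)"

definition laplacian :: "('a::euclidean_space \<Rightarrow> 'b::real_normed_vector) \<Rightarrow> 'a \<Rightarrow> 'b" where
  "laplacian f x =
     (\<Sum>i\<in>Basis. frechet_derivative (\<lambda>y. frechet_derivative f (at y) i) (at x) i)"

section \<open>The curve\<close>

definition tangent :: "(complex \<Rightarrow> complex) \<Rightarrow> real \<Rightarrow> complex" where
  "tangent \<tau> s = vector_derivative (\<lambda>r. \<tau> (cis r)) (at s)"

text \<open>
  \<open>\<Gamma>\<close> is a smooth simple closed curve and \<open>\<tau>\<close>, of which only the values on the unit circle matter,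
  is an arc length parametrization of it. Since \<open>s \<mapsto> \<tau> (cis s)\<close> has unit speed and runs once
  through \<open>\<Gamma>\<close> for \<open>0 \<le> s < 2 * pi\<close>, the length of \<open>\<Gamma>\<close> is \<open>2 * pi\<close>.
\<close>

definition arc_length_parametrization :: "(complex \<Rightarrow> complex) \<Rightarrow> complex set \<Rightarrow> bool" where
  "arc_length_parametrization \<tau> \<Gamma> \<longleftrightarrow>
     bij_betw \<tau> (sphere 0 1) \<Gamma> \<and>
     smooth_on UNIV (\<lambda>s. \<tau> (cis s)) \<and>
     (\<forall>s. norm (tangent \<tau> s) = 1)"

definition inward_unit_normal ::
  "(complex \<Rightarrow> complex) \<Rightarrow> complex set \<Rightarrow> (complex \<Rightarrow> complex) \<Rightarrow> bool" where
  "inward_unit_normal \<tau> \<Gamma> n \<longleftrightarrow>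
     (\<forall>s. norm (n (\<tau> (cis s))) = 1 \<and>
          n (\<tau> (cis s)) \<bullet> tangent \<tau> s = 0 \<and>
          (\<forall>\<^sub>F r in at_right 0. \<tau> (cis s) + r *\<^sub>R n (\<tau> (cis s)) \<in> inside \<Gamma>))"

text \<open>The sign convention makes the curvature of the unit circle equal to \<open>1\<close>.\<close>

definition signed_curvature ::
  "(complex \<Rightarrow> complex) \<Rightarrow> (complex \<Rightarrow> complex) \<Rightarrow> (complex \<Rightarrow> real) \<Rightarrow> bool" where
  "signed_curvature \<tau> n \<kappa> \<longleftrightarrow>
     (\<forall>s. (tangent \<tau> has_vector_derivative \<kappa> (\<tau> (cis s)) *\<^sub>R n (\<tau> (cis s))) (at s))"

definition smooth_projection_within :: "complex set \<Rightarrow> real \<Rightarrow> bool" where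
  "smooth_projection_within \<Gamma> \<delta> \<longleftrightarrow>
     (\<forall>z. infdist z \<Gamma> < \<delta> \<longrightarrow> (\<exists>!p. p \<in> \<Gamma> \<and> dist z p = infdist z \<Gamma>)) \<and>
     smooth_on {z. infdist z \<Gamma> < \<delta>} (closest_point \<Gamma>)"

definition from_coords ::
  "(complex \<Rightarrow> complex) \<Rightarrow> (complex \<Rightarrow> complex) \<Rightarrow> real \<Rightarrow> real \<Rightarrow> complex" where
  "from_coords \<tau> n \<phi> t = \<tau> (cis \<phi>) + t *\<^sub>R n (\<tau> (cis \<phi>))"

section \<open>The potential\<close>

definition admissible_potential :: "complex set \<Rightarrow> (complex \<Rightarrow> real) \<Rightarrow> bool" where
  "admissible_potential \<Gamma> W \<longleftrightarrow>
     smooth_on UNIV W \<and> (\<forall>z. W z \<ge> 0) \<and> W -` {0} = \<Gamma> \<and>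
     (\<exists>\<mu>>0. \<exists>\<delta>>0. \<forall>z. infdist z \<Gamma> < \<delta> \<longrightarrow> W z \<ge> \<mu> * (infdist z \<Gamma>)\<^sup>2) \<and>
     (\<exists>R0. (\<forall>z\<in>\<Gamma>. norm z < R0) \<and>
           (\<forall>z. norm z > R0 \<longrightarrow> frechet_derivative W (at z) (sgn z) \<ge> 0))"

text \<open>
  The smooth factor in \<open>W = \<alpha> t\<^sup>2\<close> on the \<open>\<delta>\<close>-neighbourhood of the curve; continuity
  determines it uniquely also at \<open>t = 0\<close>.
\<close>

definition potential_factor ::
  "(complex \<Rightarrow> complex) \<Rightarrow> (complex \<Rightarrow> complex) \<Rightarrow> (complex \<Rightarrow> real) \<Rightarrow> real \<Rightarrow>
     (real \<Rightarrow> real \<Rightarrow> real) \<Rightarrow> bool" where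
  "potential_factor \<tau> n W \<delta> \<alpha> \<longleftrightarrow>
     smooth_on (UNIV \<times> {-\<delta><..<\<delta>}) (\<lambda>(\<phi>, t). \<alpha> \<phi> t) \<and>
     (\<forall>\<phi> t. \<bar>t\<bar> < \<delta> \<longrightarrow>
        \<alpha> \<phi> t > 0 \<and> \<alpha> (\<phi> + 2 * pi) t = \<alpha> \<phi> t \<and>
        W (from_coords \<tau> n \<phi> t) = \<alpha> \<phi> t * t\<^sup>2)"

section \<open>Coefficients\<close>

definition coeff_a :: "(complex \<Rightarrow> complex) \<Rightarrow> (complex \<Rightarrow> real) \<Rightarrow> real \<Rightarrow> real \<Rightarrow> real" where
  "coeff_a \<tau> \<kappa> \<phi> t = (1 - t * \<kappa> (\<tau> (cis \<phi>)))\<^sup>2"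

definition D\<^sub>\<phi> :: "(real \<Rightarrow> real \<Rightarrow> real) \<Rightarrow> real \<Rightarrow> real \<Rightarrow> real" where
  "D\<^sub>\<phi> f \<phi> t = deriv (\<lambda>\<psi>. f \<psi> t) \<phi>"

definition D\<^sub>t :: "(real \<Rightarrow> real \<Rightarrow> real) \<Rightarrow> real \<Rightarrow> real \<Rightarrow> real" where
  "D\<^sub>t f \<phi> t = deriv (f \<phi>) t"

definition coeff_b :: "(complex \<Rightarrow> complex) \<Rightarrow> (complex \<Rightarrow> real) \<Rightarrow> real \<Rightarrow> real \<Rightarrow> real" where
  "coeff_b \<tau> \<kappa> \<phi> t = - (1 / 2) * D\<^sub>\<phi> (coeff_a \<tau> \<kappa>) \<phi> t"

definition coeff_c :: "(complex \<Rightarrow> complex) \<Rightarrow> (complex \<Rightarrow> real) \<Rightarrow> real \<Rightarrow> real \<Rightarrow> real" where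
  "coeff_c \<tau> \<kappa> \<phi> t = - (1 / 2) * D\<^sub>t (coeff_a \<tau> \<kappa>) \<phi> t"

section \<open>Critical points and extrema\<close>

text \<open>
  Classical solutions of the Euler--Lagrange equation of
  \<open>\<integral> (\<bar>\<nabla>u\<bar>\<^sup>2 / 2 + W u / \<epsilon>\<^sup>2)\<close>.
\<close>

definition critical_point_on ::
  "complex set \<Rightarrow> (complex \<Rightarrow> real) \<Rightarrow> real \<Rightarrow> (complex \<Rightarrow> complex) \<Rightarrow> bool" where
  "critical_point_on \<omega> W \<epsilon> u \<longleftrightarrow>
     Ck_on 2 \<omega> u \<and> (\<forall>x\<in>\<omega>. laplacian u x = (1 / \<epsilon>\<^sup>2) *\<^sub>R gradient W (u x))"

text \<open>Attained extrema: unlike \<open>Inf\<close> and \<open>Sup\<close> these carry no junk values.\<close>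

definition has_minimum_on :: "('a \<Rightarrow> real) \<Rightarrow> 'a set \<Rightarrow> real \<Rightarrow> bool" where
  "has_minimum_on f S v \<longleftrightarrow> v \<in> f ` S \<and> (\<forall>x\<in>S. v \<le> f x)"

definition has_maximum_on :: "('a \<Rightarrow> real) \<Rightarrow> 'a set \<Rightarrow> real \<Rightarrow> bool" where
  "has_maximum_on f S v \<longleftrightarrow> v \<in> f ` S \<and> (\<forall>x\<in>S. f x \<le> v)"

end

theory Submission
  imports Defs
begin

text \<open>
  For \<open>\<sigma> = 1\<close> and \<open>\<sigma> = - 1\<close> the function \<open>v = \<sigma> \<phi> + m t\<^sup>2 / 2\<close> is a subsolution of a linear elliptic
  inequality \<open>\<Delta>v + B \<cdot> \<nabla>v \<ge> 0\<close> in \<open>\<omega>\<close>, so it attains its maximum on the boundary; the minimum of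
  \<open>\<phi> - m t\<^sup>2 / 2\<close> is the case \<open>\<sigma> = - 1\<close>.

  Write \<open>T\<close>, \<open>N\<close> for the tangent and the normal of the curve, \<open>k\<close> for its curvature as a function of the
  phase, and \<open>q = 1 - t k(\<phi>)\<close>, so that \<open>a = q\<^sup>2\<close>. Differentiating \<open>u = \<gamma>(\<phi>) + t N(\<phi>)\<close> twice with
  the Frenet equations and projecting \<open>\<Delta>u = \<nabla>W(u) / \<epsilon>\<^sup>2\<close> onto \<open>T\<close> and \<open>N\<close> gives the system
  \<open>\<Delta>\<phi> = \<alpha>\<^sub>\<phi> t\<^sup>2 / (a \<epsilon>\<^sup>2) - (a\<^sub>t / a) \<nabla>t \<cdot> \<nabla>\<phi> + (b / a) \<bar>\<nabla>\<phi>\<bar>\<^sup>2\<close> and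
  \<open>\<Delta>t = (2 \<alpha> t + \<alpha>\<^sub>t t\<^sup>2) / \<epsilon>\<^sup>2 - c \<bar>\<nabla>\<phi>\<bar>\<^sup>2\<close>. In \<open>\<Delta>v\<close> the reaction terms combine to
  at least \<open>(m c\<^sub>1 - c\<^sub>5) t\<^sup>2 / \<epsilon>\<^sup>2 \<ge> 0\<close>: the square in \<open>v\<close> is there to absorb the term \<open>\<alpha>\<^sub>\<phi> t\<^sup>2\<close>,
  which has no sign. In the gradient terms one substitutes \<open>\<sigma> \<nabla>\<phi> = \<nabla>v - m t \<nabla>t\<close>. Everything that
  contains \<open>\<nabla>v\<close> goes into the drift \<open>B\<close>; what is left is \<open>\<bar>\<nabla>t\<bar>\<^sup>2\<close> times a coefficient that the
  smallness of \<open>\<delta>\<^sub>1\<close> makes nonnegative (\<open>barrier_subsolution\<close>, \<open>reaction_term_nonneg\<close>,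
  \<open>gradient_term_nonneg\<close>).

  Since \<open>\<nabla>u\<close> may blow up at the boundary, \<open>B\<close> is only continuous in \<open>\<omega>\<close>. The maximum principle still
  holds (\<open>weak_maximum_principle\<close>): if an interior value exceeded all boundary values, the superlevel
  sets slightly above the latter would be compact subsets of \<open>\<omega>\<close>, and on those \<open>B\<close> is bounded.

  Three points have to be settled before the computation makes sense. The coordinates \<open>\<phi>\<close>, \<open>t\<close> are only
  assumed continuous; they are differentiable because \<open>(p, s) \<mapsto> \<gamma>(p) + s N(p)\<close> has an invertible
  differential (\<open>has_derivative_of_composition\<close>). This needs \<open>q \<noteq> 0\<close>, which follows from the bound on
  \<open>a\<^sub>t / a\<close>, as this quotient blows up at focal points (\<open>no_focal_point\<close>). Finally the normal is given
  only pointwise as the unit normal that points inward; that it is a smooth function of the phase rests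
  on the Jordan curve theorem (\<open>normal_is_rotated_tangent\<close>).
\<close>

section \<open>A maximum principle with locally bounded drift\<close>

text \<open>
  The gradient of \<open>v\<close> enters as a vector field \<open>g\<close> and the Hessian as the derivative of \<open>g\<close>. If
  \<open>H h \<cdot> h\<close> were positive, the derivative of \<open>v\<close> along the line in direction \<open>h\<close> would vanish
  at \<open>x\<close> and be positive just after it, and \<open>v\<close> would increase along that line.
\<close>

lemma local_max_second_order:
  fixes v :: "'a::euclidean_space \<Rightarrow> real"
  assumes U: "open U" "x \<in> U"
    and max: "\<And>y. y \<in> U \<Longrightarrow> v y \<le> v x"
    and g: "\<And>y. y \<in> U \<Longrightarrow> (v has_derivative (\<lambda>h. g y \<bullet> h)) (at y)"
    and H: "(g has_derivative H) (at x)"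
  shows "g x = 0" and "H h \<bullet> h \<le> 0"
proof -
  have "(\<lambda>h. g x \<bullet> h) = (\<lambda>h. 0)"
    using differential_zero_maxmin[OF U(2,1) g[OF U(2)]] max by blast
  then have "g x \<bullet> g x = 0" by metis
  then show gx: "g x = 0" by simp
  show "H h \<bullet> h \<le> 0"
  proof (rule ccontr)
    assume "\<not> H h \<bullet> h \<le> 0"
    then have pos: "H h \<bullet> h > 0" by simp
    define l where "l = (\<lambda>r::real. x + r *\<^sub>R h)"
    have l: "(l has_derivative (\<lambda>r. r *\<^sub>R h)) (at r)" for r
      unfolding l_def by (auto intro!: derivative_eq_intros)
    have l0: "l 0 = x" by (simp add: l_def)
    have Hlin: "bounded_linear H" using H by (rule has_derivative_bounded_linear)
    have "((\<lambda>r. g (l r)) has_derivative (\<lambda>r. H (r *\<^sub>R h))) (at 0)"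
      using has_derivative_compose[OF l[of 0], of g H] H l0 by (simp add: o_def)
    then have "((\<lambda>r. g (l r) \<bullet> h) has_derivative (\<lambda>r. H (r *\<^sub>R h) \<bullet> h)) (at 0)"
      by (rule has_derivative_inner_left)
    then have D2: "((\<lambda>r. g (l r) \<bullet> h) has_real_derivative H h \<bullet> h) (at 0)"
      by (rule has_derivative_imp_has_field_derivative)
        (simp add: linear_cmul[OF bounded_linear.linear[OF Hlin]])
    have D1: "((\<lambda>r. v (l r)) has_real_derivative g (l r) \<bullet> h) (at r)" if "l r \<in> U" for r
      by (rule has_derivative_imp_has_field_derivative[OF has_derivative_compose[OF l g[OF that]]]) simp
    have "continuous_on UNIV l" unfolding l_def by (intro continuous_intros)
    then have "open (l -` U)" using U(1) by (simp add: open_vimage)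
    moreover have "0 \<in> l -` U" using U(2) l0 by simp
    ultimately obtain d where d: "d > 0" "ball 0 d \<subseteq> l -` U"
      using open_contains_ball by blast
    obtain d' where d': "d' > 0" "\<And>r. 0 < r \<Longrightarrow> r < d' \<Longrightarrow> 0 < g (l r) \<bullet> h"
      using DERIV_pos_inc_right[OF D2 pos] gx l0 by auto
    define r where "r = min d d' / 2"
    have r: "0 < r" "r < d" "r < d'" using d d' by (auto simp: r_def)
    have inU: "l s \<in> U" if "0 \<le> s" "s \<le> r" for s
    proof -
      have "s \<in> ball 0 d" using that r(2) by (simp add: dist_real_def)
      then show ?thesis using d(2) by blast
    qed
    have "v (l 0) < v (l r)"
    proof (rule DERIV_pos_imp_increasing_open[OF r(1)])
      show "\<exists>y. ((\<lambda>r. v (l r)) has_real_derivative y) (at s) \<and> 0 < y" if "0 < s" "s < r" for s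
        using D1[OF inU] d'(2)[of s] that r by (meson less_imp_le less_trans)
      show "continuous_on {0..r} (\<lambda>r. v (l r))"
        by (intro continuous_at_imp_continuous_on ballI DERIV_isCont[OF D1] inU) auto
    qed
    with max[OF inU[of r]] l0 r show False by simp
  qed
qed

text \<open>
  Suppose that the value at \<open>x\<close> exceeds all boundary values, and pick a level \<open>c\<close> in between. The
  superlevel set \<open>K = {v \<ge> c}\<close> is a compact subset of \<open>\<omega>\<close>, so \<open>B\<close> is bounded on it by some \<open>b\<close>. Adding
  a small multiple of \<open>exp (l y \<cdot> e)\<close> with \<open>l > b\<close> makes the differential inequality strict
  on \<open>K\<close>, but keeps the maximum over \<open>K\<close> in the open set \<open>{v > c}\<close>, where it contradicts the second
  order conditions.
\<close>

lemma weak_maximum_principle: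
  fixes v :: "'a::euclidean_space \<Rightarrow> real"
  assumes \<omega>: "open \<omega>" "bounded \<omega>"
    and v: "continuous_on (closure \<omega>) v"
    and g: "\<And>x. x \<in> \<omega> \<Longrightarrow> (v has_derivative (\<lambda>h. g x \<bullet> h)) (at x)"
    and B: "continuous_on \<omega> B"
    and sub: "\<And>x. x \<in> \<omega> \<Longrightarrow>
      \<exists>H. (g has_derivative H) (at x) \<and> 0 \<le> (\<Sum>i\<in>Basis. H i \<bullet> i) + B x \<bullet> g x"
    and x: "x \<in> closure \<omega>"
  shows "\<exists>y\<in>frontier \<omega>. v x \<le> v y"
proof (rule ccontr)
  assume "\<not> ?thesis"
  then have less: "\<And>y. y \<in> frontier \<omega> \<Longrightarrow> v y < v x" by force
  have fr: "compact (frontier \<omega>)" using \<omega> by (simp add: compact_frontier_bounded)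
  obtain c where c: "c < v x" "\<And>y. y \<in> frontier \<omega> \<Longrightarrow> v y < c"
  proof (cases "frontier \<omega> = {}")
    case True
    then show ?thesis using that[of "v x - 1"] by auto
  next
    case False
    have "continuous_on (frontier \<omega>) v"
      using v by (rule continuous_on_subset) (auto simp: frontier_def)
    then obtain y where y: "y \<in> frontier \<omega>" "\<And>z. z \<in> frontier \<omega> \<Longrightarrow> v z \<le> v y"
      using continuous_attains_sup[OF fr False] by blast
    show ?thesis
      using that[of "(v x + v y) / 2"] less[OF y(1)] y(2) by fastforce
  qed
  define K where "K = {y \<in> closure \<omega>. c \<le> v y}"
  have "closed K"
    using continuous_closed_preimage[OF v closed_closure closed_atLeast, of c]
    by (simp add: K_def Int_def)
  then have cK: "compact K"
    using \<open>closed K\<close> bounded_subset[OF bounded_closure[OF \<omega>(2)], of K]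
    by (auto simp: compact_eq_bounded_closed K_def)
  have K\<omega>: "K \<subseteq> \<omega>"
    using c(2) closure_Un_frontier[of \<omega>] by (force simp: K_def)
  have xK: "x \<in> K" using x c by (simp add: K_def)
  have "compact (B ` K)"
    by (rule compact_continuous_image[OF continuous_on_subset[OF B K\<omega>] cK])
  then obtain b where b: "b > 0" "\<And>y. y \<in> K \<Longrightarrow> norm (B y) \<le> b"
    using bounded_pos[of "B ` K"] compact_imp_bounded[of "B ` K"] by auto
  obtain e :: 'a where e: "e \<in> Basis" using nonempty_Basis by blast
  define l where "l = b + 1"
  define E where "E = (\<lambda>y::'a. exp (l * (y \<bullet> e)))"
  have Econt: "continuous_on K E" unfolding E_def by (intro continuous_intros)
  have Epos: "E y > 0" for y unfolding E_def by (rule exp_gt_zero)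
  obtain z where z: "z \<in> K" "\<And>y. y \<in> K \<Longrightarrow> E y \<le> E z"
    using continuous_attains_sup[OF cK _ Econt] xK by blast
  \<comment> \<open>So small that the perturbation cannot bridge the gap between \<open>v x\<close> and the level \<open>c\<close>.\<close>
  define \<eta> where "\<eta> = (v x - c) / (2 * E z)"
  have \<eta>: "\<eta> > 0" using c Epos by (simp add: \<eta>_def)
  have \<eta>E: "\<eta> * E y < v x - c" if "y \<in> K" for y
  proof -
    have "\<eta> * E y \<le> \<eta> * E z" using z(2)[OF that] \<eta> by simp
    also have "\<dots> = (v x - c) / 2" using Epos[of z] by (simp add: \<eta>_def)
    also have "\<dots> < v x - c" using c by simp
    finally show ?thesis .
  qed
  define w where "w = (\<lambda>y. v y + \<eta> * E y)"
  have "continuous_on K w"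
    unfolding w_def
    by (intro continuous_on_add continuous_on_mult continuous_on_const Econt
        continuous_on_subset[OF v]) (auto simp: K_def)
  then obtain p where p: "p \<in> K" "\<And>y. y \<in> K \<Longrightarrow> w y \<le> w p"
    using continuous_attains_sup[OF cK] xK by blast
  have vp: "c < v p"
    using p(2)[OF xK] \<eta>E[OF p(1)] mult_pos_pos[OF \<eta> Epos[of x]] by (simp add: w_def)
  define U where "U = {y \<in> \<omega>. c < v y}"
  have U\<omega>: "U \<subseteq> \<omega>" and UK: "U \<subseteq> K" using closure_subset by (auto simp: U_def K_def)
  have "continuous_on \<omega> v" using v closure_subset by (rule continuous_on_subset)
  then have "open U"
    using continuous_open_preimage[OF _ \<omega>(1) open_greaterThan, of v c]
    by (simp add: U_def Int_def)
  have pU: "p \<in> U" using p K\<omega> vp by (auto simp: U_def)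
  obtain H where H: "(g has_derivative H) (at p)"
    and subp: "0 \<le> (\<Sum>i\<in>Basis. H i \<bullet> i) + B p \<bullet> g p"
    using sub pU U\<omega> by blast
  define G where "G = (\<lambda>y. g y + (\<eta> * l * E y) *\<^sub>R e)"
  have DE: "(E has_derivative (\<lambda>h. l * E y * (e \<bullet> h))) (at y)" for y
    unfolding E_def by (auto intro!: derivative_eq_intros simp: fun_eq_iff inner_commute)
  have DG: "(w has_derivative (\<lambda>h. G y \<bullet> h)) (at y)" if "y \<in> U" for y
    unfolding w_def using U\<omega> that
    by (auto intro!: derivative_eq_intros g DE simp: G_def fun_eq_iff inner_left_distrib)
  have DH: "(G has_derivative (\<lambda>h. H h + (\<eta> * l * (l * E p * (e \<bullet> h))) *\<^sub>R e)) (at p)"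
    unfolding G_def using U\<omega> pU
    by (auto intro!: derivative_eq_intros H DE simp: fun_eq_iff)
  have max: "w y \<le> w p" if "y \<in> U" for y using that UK p(2) by blast
  have "G p = 0" by (rule local_max_second_order(1)[OF \<open>open U\<close> pU max DG DH])
  then have gp: "g p = - (\<eta> * l * E p) *\<^sub>R e" by (simp add: G_def eq_neg_iff_add_eq_0)
  have "(\<Sum>i\<in>Basis. (H i + (\<eta> * l * (l * E p * (e \<bullet> i))) *\<^sub>R e) \<bullet> i) \<le> 0"
    by (intro sum_nonpos local_max_second_order(2)[OF \<open>open U\<close> pU max DG DH])
  moreover have "(\<Sum>i\<in>Basis. (e \<bullet> i) * (e \<bullet> i)) = 1"
    using e euclidean_inner[of e e] by (simp add: inner_Basis)
  ultimately have "(\<Sum>i\<in>Basis. H i \<bullet> i) + \<eta> * l * (l * E p) \<le> 0"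
    by (simp add: inner_left_distrib sum.distrib mult.assoc flip: sum_distrib_left)
  with subp have "\<eta> * l * E p * l \<le> \<eta> * l * E p * (- (B p \<bullet> e))"
    by (simp add: gp mult_ac)
  moreover have "\<eta> * l * E p > 0" using \<eta> Epos[of p] b(1) by (simp add: l_def)
  ultimately have "l \<le> - (B p \<bullet> e)" by (simp only: mult_le_cancel_left_pos)
  also have "\<dots> \<le> norm (B p)"
    using Basis_le_norm[OF e, of "B p"] by linarith
  also have "\<dots> \<le> b" using b(2) p(1) by blast
  finally show False by (simp add: l_def)
qed

section \<open>Differentiability of coordinate functions\<close>

text \<open>
  A form of the implicit function theorem that starts from a continuous solution: if \<open>f\<close> has an injective
  differential with left inverse \<open>L\<close>, a continuous \<open>g\<close> inherits differentiability from \<open>f \<circ> g\<close>.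
  The remainder of \<open>g\<close> is \<open>L\<close> applied to the difference of the remainders of \<open>f \<circ> g\<close> and of \<open>f\<close>.
  The latter is small relative to \<open>\<parallel>g y - g x\<parallel>\<close>; absorbing half of this norm first
  shows that \<open>g\<close> is Lipschitz at \<open>x\<close>, and then the remainder is small relative to \<open>\<parallel>y - x\<parallel>\<close>.
\<close>

lemma has_derivative_of_composition:
  fixes f :: "'b::real_normed_vector \<Rightarrow> 'c::real_normed_vector"
    and g :: "'a::real_normed_vector \<Rightarrow> 'b"
  assumes f: "(f has_derivative f') (at (g x))"
    and L: "bounded_linear L" "\<And>h. L (f' h) = h"
    and g: "isCont g x"
    and u: "((\<lambda>y. f (g y)) has_derivative u') (at x)"
  shows "(g has_derivative (\<lambda>h. L (u' h))) (at x)"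
proof -
  interpret L: bounded_linear L by fact
  interpret u': bounded_linear u' using u by (rule has_derivative_bounded_linear)
  interpret f': bounded_linear f' using f by (rule has_derivative_bounded_linear)
  obtain CL where CL: "CL > 0" "\<And>h. norm (L h) \<le> norm h * CL" using L.pos_bounded by blast
  obtain Cu where Cu: "Cu > 0" "\<And>h. norm (u' h) \<le> norm h * Cu" using u'.pos_bounded by blast
  have near_f: "\<forall>\<^sub>F y in at x. norm (f (g y) - f (g x) - f' (g y - g x)) \<le> e * norm (g y - g x)"
    if e: "e > 0" for e
  proof -
    obtain d where d: "d > 0"
      "\<And>z. norm (z - g x) < d \<Longrightarrow> norm (f z - f (g x) - f' (z - g x)) \<le> e * norm (z - g x)"
      using f[unfolded has_derivative_at_alt, THEN conjunct2, rule_format, OF e] by blast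
    have "\<forall>\<^sub>F y in at x. dist (g y) (g x) < d"
      using g d(1) by (simp add: isCont_def tendsto_iff)
    then show ?thesis by eventually_elim (auto simp: dist_norm d)
  qed
  have near_u: "\<forall>\<^sub>F y in at x. norm (f (g y) - f (g x) - u' (y - x)) \<le> e * norm (y - x)"
    if e: "e > 0" for e
  proof -
    obtain d where d: "d > 0"
      "\<And>z. norm (z - x) < d \<Longrightarrow> norm (f (g z) - f (g x) - u' (z - x)) \<le> e * norm (z - x)"
      using u[unfolded has_derivative_at_alt, THEN conjunct2, rule_format, OF e] by blast
    then show ?thesis unfolding eventually_at by (metis dist_norm)
  qed
  have split: "g y - g x - L (u' (y - x)) =
      L ((f (g y) - f (g x) - u' (y - x)) - (f (g y) - f (g x) - f' (g y - g x)))" for y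
    by (simp add: L.diff L(2))
  have Lb: "norm (L (p - q)) \<le> (a + b) * CL" if "norm p \<le> a" "norm q \<le> b" for p q a b
    using CL(2)[of "p - q"] norm_triangle_ineq4[of p q] that
      mult_right_mono[of "norm (p - q)" "a + b" CL] CL(1) by linarith
  have "1 / (2 * CL) > 0" using CL by simp
  from near_f[OF this] near_u[OF zero_less_one]
  have lip: "\<forall>\<^sub>F y in at x. norm (g y - g x) \<le> 2 * CL * (1 + Cu) * norm (y - x)"
  proof eventually_elim
    case (elim y)
    have "norm (g y - g x) \<le> norm (g y - g x - L (u' (y - x))) + norm (L (u' (y - x)))"
      by (metis diff_add_cancel norm_triangle_ineq)
    also have "norm (g y - g x - L (u' (y - x))) \<le>
        (1 * norm (y - x) + 1 / (2 * CL) * norm (g y - g x)) * CL"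
      unfolding split using elim(2,1) by (rule Lb)
    also have "norm (L (u' (y - x))) \<le> norm (y - x) * Cu * CL"
      using CL(2)[of "u' (y - x)"] Cu(2)[of "y - x"] CL(1)
      by (meson mult_right_mono less_imp_le order_trans)
    also have "(1 * norm (y - x) + 1 / (2 * CL) * norm (g y - g x)) * CL =
        norm (y - x) * CL + norm (g y - g x) / 2"
      using CL(1) by (simp add: field_simps)
    finally show ?case by (simp add: algebra_simps)
  qed
  show ?thesis
    unfolding has_derivative_at_alt
  proof (intro conjI allI impI)
    show "bounded_linear (\<lambda>h. L (u' h))"
      using L(1) u'.bounded_linear_axioms by (rule bounded_linear_compose)
    fix e :: real assume e: "e > 0"
    define M where "M = 2 * CL * (1 + Cu)"
    have M: "M > 0" using CL Cu by (simp add: M_def)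
    have "e / (2 * CL * M) > 0" "e / (2 * CL) > 0" using CL M e by auto
    from near_f[OF this(1)] near_u[OF this(2)] lip
    have "\<forall>\<^sub>F y in at x. norm (g y - g x - L (u' (y - x))) \<le> e * norm (y - x)"
    proof eventually_elim
      case (elim y)
      have "norm (g y - g x - L (u' (y - x))) \<le>
          (e / (2 * CL) * norm (y - x) + e / (2 * CL * M) * norm (g y - g x)) * CL"
        unfolding split using elim(2,1) by (rule Lb)
      also have "\<dots> \<le> (e / (2 * CL) * norm (y - x) + e / (2 * CL * M) * (M * norm (y - x))) * CL"
        using elim(3) CL(1) M e
        by (intro mult_right_mono add_mono mult_left_mono) (auto simp: M_def)
      also have "\<dots> = e * norm (y - x)" using CL(1) M by (simp add: field_simps)
      finally show ?case .
    qed
    then obtain d where d: "d > 0"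
      "\<And>y. y \<noteq> x \<Longrightarrow> dist y x < d \<Longrightarrow> norm (g y - g x - L (u' (y - x))) \<le> e * norm (y - x)"
      unfolding eventually_at by blast
    have "norm (g y - g x - L (u' (y - x))) \<le> e * norm (y - x)" if "norm (y - x) < d" for y
      using d(2)[of y] that by (cases "y = x") (auto simp: dist_norm L.zero u'.zero)
    then show "\<exists>d>0. \<forall>y. norm (y - x) < d \<longrightarrow>
        norm (g y - g x - L (u' (y - x))) \<le> e * norm (y - x)"
      using d(1) by blast
  qed
qed

section \<open>The Laplacians of the coordinates\<close>

text \<open>
  The Riesz representation in coordinates; it turns differentials into gradients.
\<close>

lemma functional_eq_inner:
  fixes l :: "'a::euclidean_space \<Rightarrow> real"
  assumes "linear l"
  shows "(\<Sum>i\<in>Basis. l i *\<^sub>R i) \<bullet> h = l h"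
proof -
  have "l h = l (\<Sum>i\<in>Basis. (h \<bullet> i) *\<^sub>R i)" by (simp add: euclidean_representation)
  also have "\<dots> = (\<Sum>i\<in>Basis. (h \<bullet> i) * l i)"
    using assms by (simp add: linear_sum linear_cmul)
  finally show ?thesis
    by (simp only: inner_sum_left inner_scaleR_left) (simp add: inner_commute mult.commute)
qed

lemma sum_over_Basis_inner:
  fixes i :: "'a::euclidean_space"
  assumes "i \<in> Basis"
  shows "(\<Sum>j\<in>Basis. f j *\<^sub>R j) \<bullet> i = f i"
  using assms by (simp add: inner_sum_left inner_Basis if_distrib sum.delta cong: if_cong)

text \<open>
  The Frenet equations of a unit speed curve in an arbitrary inner product space whose normal derivative
  stays tangential; for plane curves \<open>k\<close> is the signed curvature with respect to \<open>N\<close>.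
\<close>

locale moving_frame =
  fixes \<gamma> T N :: "real \<Rightarrow> 'b::real_inner" and k k' :: "real \<Rightarrow> real"
  assumes \<gamma>: "\<And>p. (\<gamma> has_vector_derivative T p) (at p)"
    and T: "\<And>p. (T has_vector_derivative k p *\<^sub>R N p) (at p)"
    and N: "\<And>p. (N has_vector_derivative - k p *\<^sub>R T p) (at p)"
    and k: "\<And>p. (k has_real_derivative k' p) (at p)"
    and k': "continuous_on UNIV k'"
    and TT: "\<And>p. T p \<bullet> T p = 1" and NN: "\<And>p. N p \<bullet> N p = 1" and TN: "\<And>p. T p \<bullet> N p = 0"

text \<open>
  \<open>U x\<close> is the differential of \<open>u\<close> at \<open>x\<close>, and \<open>U2 x i\<close> is the differential of the partial
  derivative of \<open>u\<close> in direction \<open>i\<close>. The coordinates are merely continuous here; their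
  regularity is derived from that of \<open>u\<close>.
\<close>

locale normal_coordinates = moving_frame \<gamma> T N k k'
  for \<gamma> T N :: "real \<Rightarrow> 'b::real_inner" and k k' +
  fixes \<omega> :: "'a::euclidean_space set" and u :: "'a \<Rightarrow> 'b"
    and U :: "'a \<Rightarrow> 'a \<Rightarrow> 'b" and U2 :: "'a \<Rightarrow> 'a \<Rightarrow> 'a \<Rightarrow> 'b" and \<phi> t :: "'a \<Rightarrow> real"
  assumes open_\<omega>: "open \<omega>"
    and U: "\<And>x. x \<in> \<omega> \<Longrightarrow> (u has_derivative U x) (at x)"
    and U2: "\<And>x i. x \<in> \<omega> \<Longrightarrow> i \<in> Basis \<Longrightarrow> ((\<lambda>y. U y i) has_derivative U2 x i) (at x)"
    and cont: "continuous_on \<omega> \<phi>" "continuous_on \<omega> t"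
    and coords: "\<And>x. x \<in> \<omega> \<Longrightarrow> u x = \<gamma> (\<phi> x) + t x *\<^sub>R N (\<phi> x)"
    and nondegenerate: "\<And>x. x \<in> \<omega> \<Longrightarrow> 1 - t x * k (\<phi> x) \<noteq> 0"
begin

text \<open>
  The Jacobian of \<open>(p, s) \<mapsto> \<gamma> p + s N p\<close>: its derivative in \<open>p\<close> is \<open>(1 - s k p) T p\<close>.
\<close>

definition q :: "'a \<Rightarrow> real" where "q x = 1 - t x * k (\<phi> x)"

text \<open>
  The gradients of \<open>\<phi>\<close> and \<open>t\<close>, obtained by projecting \<open>\<partial>\<^sub>i u = q (\<partial>\<^sub>i \<phi>) T + (\<partial>\<^sub>i t) N\<close>
  onto the frame. They are defined from \<open>u\<close> so as to make sense before the differentiability of the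
  coordinates is known, and so that they can be differentiated again.
\<close>

definition grad_\<phi> :: "'a \<Rightarrow> 'a" where
  "grad_\<phi> x = (\<Sum>i\<in>Basis. (U x i \<bullet> T (\<phi> x) / q x) *\<^sub>R i)"

definition grad_t :: "'a \<Rightarrow> 'a" where
  "grad_t x = (\<Sum>i\<in>Basis. (U x i \<bullet> N (\<phi> x)) *\<^sub>R i)"

definition lap_u :: "'a \<Rightarrow> 'b" where "lap_u x = (\<Sum>i\<in>Basis. U2 x i i)"

lemma q_nonzero: "x \<in> \<omega> \<Longrightarrow> q x \<noteq> 0"
  using nondegenerate by (simp add: q_def)

lemma grad_\<phi>_inner: "x \<in> \<omega> \<Longrightarrow> grad_\<phi> x \<bullet> h = U x h \<bullet> T (\<phi> x) / q x"
  and grad_t_inner: "x \<in> \<omega> \<Longrightarrow> grad_t x \<bullet> h = U x h \<bullet> N (\<phi> x)"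
proof -
  assume x: "x \<in> \<omega>"
  have lin: "linear (U x)" using has_derivative_linear[OF U[OF x]] .
  have l: "linear (\<lambda>h. U x h \<bullet> T (\<phi> x) / q x)" "linear (\<lambda>h. U x h \<bullet> N (\<phi> x))"
    using lin by (auto intro!: linearI simp: linear_add linear_cmul inner_left_distrib add_divide_distrib)
  show "grad_\<phi> x \<bullet> h = U x h \<bullet> T (\<phi> x) / q x" "grad_t x \<bullet> h = U x h \<bullet> N (\<phi> x)"
    unfolding grad_\<phi>_def grad_t_def using l by (auto intro: functional_eq_inner)
qed

lemma coords_has_derivative:
  assumes x: "x \<in> \<omega>"
  shows "((\<lambda>y. (\<phi> y, t y)) has_derivative (\<lambda>h. (grad_\<phi> x \<bullet> h, grad_t x \<bullet> h))) (at x)"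
proof -
  define F where "F = (\<lambda>z. \<gamma> (fst z) + snd z *\<^sub>R N (fst z))"
  define L where "L = (\<lambda>w. (w \<bullet> T (\<phi> x) / q x, w \<bullet> N (\<phi> x)))"
  have g: "((\<lambda>z. \<gamma> (fst z)) has_derivative (\<lambda>h. fst h *\<^sub>R T (fst z))) (at z)" for z :: "real \<times> real"
    by (rule has_derivative_compose[OF has_derivative_fst[OF has_derivative_ident]
          \<gamma>[unfolded has_vector_derivative_def]])
  have n: "((\<lambda>z. N (fst z)) has_derivative (\<lambda>h. fst h *\<^sub>R - k (fst z) *\<^sub>R T (fst z))) (at z)" for z :: "real \<times> real"
    by (rule has_derivative_compose[OF has_derivative_fst[OF has_derivative_ident]
          N[unfolded has_vector_derivative_def]])
  have "(F has_derivative (\<lambda>h. (fst h * q x) *\<^sub>R T (\<phi> x) + snd h *\<^sub>R N (\<phi> x))) (at (\<phi> x, t x))"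
    unfolding F_def
    by (rule derivative_eq_intros g n refl)+ (simp add: fun_eq_iff q_def algebra_simps)
  moreover have "bounded_linear L"
    unfolding L_def
    by (intro bounded_linear_Pair bounded_linear_compose[OF bounded_linear_divide] bounded_linear_inner_left)
  moreover have "L ((fst h * q x) *\<^sub>R T (\<phi> x) + snd h *\<^sub>R N (\<phi> x)) = h" for h
    using q_nonzero[OF x] TT NN TN
    by (simp add: L_def inner_left_distrib inner_commute[of "N _" "T _"])
  moreover have "isCont (\<lambda>y. (\<phi> y, t y)) x"
    using cont open_\<omega> x by (simp add: continuous_on_eq_continuous_at)
  moreover have "((\<lambda>y. F (\<phi> y, t y)) has_derivative U x) (at x)"
    by (rule has_derivative_transform_within_open[OF U[OF x] open_\<omega> x]) (simp add: F_def coords)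
  ultimately have "((\<lambda>y. (\<phi> y, t y)) has_derivative (\<lambda>h. L (U x h))) (at x)"
    by (rule has_derivative_of_composition)
  then show ?thesis by (simp add: L_def grad_\<phi>_inner[OF x] grad_t_inner[OF x])
qed

lemma \<phi>_has_derivative: "x \<in> \<omega> \<Longrightarrow> (\<phi> has_derivative (\<lambda>h. grad_\<phi> x \<bullet> h)) (at x)"
  using has_derivative_fst[OF coords_has_derivative] by simp

lemma t_has_derivative: "x \<in> \<omega> \<Longrightarrow> (t has_derivative (\<lambda>h. grad_t x \<bullet> h)) (at x)"
  using has_derivative_snd[OF coords_has_derivative] by simp

lemma frame_along_\<phi>:
  assumes x: "x \<in> \<omega>"
  shows DT: "((\<lambda>y. T (\<phi> y)) has_derivative (\<lambda>h. (grad_\<phi> x \<bullet> h) *\<^sub>R (k (\<phi> x) *\<^sub>R N (\<phi> x)))) (at x)"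
    and DN: "((\<lambda>y. N (\<phi> y)) has_derivative (\<lambda>h. (grad_\<phi> x \<bullet> h) *\<^sub>R (- k (\<phi> x) *\<^sub>R T (\<phi> x)))) (at x)"
    and Dk: "((\<lambda>y. k (\<phi> y)) has_derivative (\<lambda>h. k' (\<phi> x) * (grad_\<phi> x \<bullet> h))) (at x)"
proof -
  show "((\<lambda>y. T (\<phi> y)) has_derivative (\<lambda>h. (grad_\<phi> x \<bullet> h) *\<^sub>R (k (\<phi> x) *\<^sub>R N (\<phi> x)))) (at x)"
    by (rule has_derivative_compose[OF \<phi>_has_derivative[OF x] T[unfolded has_vector_derivative_def]])
  show "((\<lambda>y. N (\<phi> y)) has_derivative (\<lambda>h. (grad_\<phi> x \<bullet> h) *\<^sub>R (- k (\<phi> x) *\<^sub>R T (\<phi> x)))) (at x)"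
    by (rule has_derivative_compose[OF \<phi>_has_derivative[OF x] N[unfolded has_vector_derivative_def]])
  show "((\<lambda>y. k (\<phi> y)) has_derivative (\<lambda>h. k' (\<phi> x) * (grad_\<phi> x \<bullet> h))) (at x)"
    by (rule has_derivative_compose[OF \<phi>_has_derivative[OF x] k[unfolded has_field_derivative_def]])
qed

lemma q_has_derivative:
  assumes x: "x \<in> \<omega>"
  shows "(q has_derivative (\<lambda>h. - (grad_t x \<bullet> h) * k (\<phi> x) - t x * k' (\<phi> x) * (grad_\<phi> x \<bullet> h))) (at x)"
proof -
  have "((\<lambda>x. 1 - t x * k (\<phi> x)) has_derivative
      (\<lambda>h. - (grad_t x \<bullet> h) * k (\<phi> x) - t x * k' (\<phi> x) * (grad_\<phi> x \<bullet> h))) (at x)"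
    by (rule derivative_eq_intros t_has_derivative[OF x] Dk[OF x] refl)+ (simp add: fun_eq_iff algebra_simps)
  then show ?thesis by (simp add: q_def[abs_def])
qed

text \<open>
  Differentiating \<open>q \<partial>\<^sub>i \<phi> = \<partial>\<^sub>i u \<cdot> T(\<phi>)\<close> once more, each of the frame and the
  Jacobian contributes one term \<open>k \<nabla>\<phi> \<cdot> \<nabla>t\<close>, and the curvature derivative the term
  in \<open>\<bar>\<nabla>\<phi>\<bar>\<^sup>2\<close>.
\<close>

lemma divergence_grad_\<phi>:
  assumes x: "x \<in> \<omega>"
  shows "\<exists>H. (grad_\<phi> has_derivative H) (at x) \<and>
    (\<Sum>i\<in>Basis. H i \<bullet> i) =
      (lap_u x \<bullet> T (\<phi> x) + 2 * k (\<phi> x) * (grad_\<phi> x \<bullet> grad_t x) + t x * k' (\<phi> x) * (grad_\<phi> x \<bullet> grad_\<phi> x)) / q x"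
proof -
  have q: "q x \<noteq> 0" using q_nonzero[OF x] .
  define D where "D = (\<lambda>i h. ((U2 x i h \<bullet> T (\<phi> x) + (grad_\<phi> x \<bullet> h) * k (\<phi> x) * (grad_t x \<bullet> i)) * q x
    + (grad_\<phi> x \<bullet> i) * q x * ((grad_t x \<bullet> h) * k (\<phi> x) + t x * k' (\<phi> x) * (grad_\<phi> x \<bullet> h))) / (q x)\<^sup>2)"
  have D: "((\<lambda>y. U y i \<bullet> T (\<phi> y) / q y) has_derivative D i) (at x)" if i: "i \<in> Basis" for i
    by (rule derivative_eq_intros U2[OF x i] DT[OF x] q_has_derivative[OF x] q refl)+
      (use q in \<open>simp add: fun_eq_iff D_def grad_\<phi>_inner[OF x] grad_t_inner[OF x] field_simps power2_eq_square\<close>)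
  have deriv_grad: "(grad_\<phi> has_derivative (\<lambda>h. \<Sum>i\<in>Basis. D i h *\<^sub>R i)) (at x)"
    unfolding grad_\<phi>_def[abs_def] by (intro has_derivative_sum has_derivative_scaleR_left D)
  have "(\<Sum>i\<in>Basis. (\<Sum>j\<in>Basis. D j i *\<^sub>R j) \<bullet> i) =
      (\<Sum>i\<in>Basis. (U2 x i i \<bullet> T (\<phi> x) + 2 * k (\<phi> x) * ((grad_\<phi> x \<bullet> i) * (grad_t x \<bullet> i))
         + t x * k' (\<phi> x) * ((grad_\<phi> x \<bullet> i) * (grad_\<phi> x \<bullet> i))) / q x)"
  proof (rule sum.cong[OF refl])
    fix i :: 'a assume "i \<in> Basis"
    then have "(\<Sum>j\<in>Basis. D j i *\<^sub>R j) \<bullet> i = D i i" by (rule sum_over_Basis_inner)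
    also have "\<dots> = (U2 x i i \<bullet> T (\<phi> x) + 2 * k (\<phi> x) * ((grad_\<phi> x \<bullet> i) * (grad_t x \<bullet> i))
         + t x * k' (\<phi> x) * ((grad_\<phi> x \<bullet> i) * (grad_\<phi> x \<bullet> i))) / q x"
      using q by (simp add: D_def field_simps power2_eq_square)
    finally show "(\<Sum>j\<in>Basis. D j i *\<^sub>R j) \<bullet> i = \<dots>" .
  qed
  also have "\<dots> = (lap_u x \<bullet> T (\<phi> x) + 2 * k (\<phi> x) * (grad_\<phi> x \<bullet> grad_t x)
      + t x * k' (\<phi> x) * (grad_\<phi> x \<bullet> grad_\<phi> x)) / q x"
    unfolding euclidean_inner[of "grad_\<phi> x" "grad_t x"] euclidean_inner[of "grad_\<phi> x" "grad_\<phi> x"] lap_u_def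
    by (simp only: sum_divide_distrib[symmetric] sum.distrib sum_distrib_left[symmetric] inner_sum_left)
  finally have tr: "(\<Sum>i\<in>Basis. (\<Sum>j\<in>Basis. D j i *\<^sub>R j) \<bullet> i) =
    (lap_u x \<bullet> T (\<phi> x) + 2 * k (\<phi> x) * (grad_\<phi> x \<bullet> grad_t x) + t x * k' (\<phi> x) * (grad_\<phi> x \<bullet> grad_\<phi> x)) / q x" .
  show ?thesis by (rule exI, rule conjI, rule deriv_grad, rule tr)
qed

text \<open>
  Here only the rotation of the normal contributes, since \<open>\<partial>\<^sub>i t = \<partial>\<^sub>i u \<cdot> N(\<phi>)\<close> has no
  Jacobian factor.
\<close>

lemma divergence_grad_t:
  assumes x: "x \<in> \<omega>"
  shows "\<exists>H. (grad_t has_derivative H) (at x) \<and>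
    (\<Sum>i\<in>Basis. H i \<bullet> i) = lap_u x \<bullet> N (\<phi> x) - k (\<phi> x) * q x * (grad_\<phi> x \<bullet> grad_\<phi> x)"
proof -
  have q: "q x \<noteq> 0" using q_nonzero[OF x] .
  define D where "D = (\<lambda>i h. U2 x i h \<bullet> N (\<phi> x) - (grad_\<phi> x \<bullet> h) * k (\<phi> x) * q x * (grad_\<phi> x \<bullet> i))"
  have D: "((\<lambda>y. U y i \<bullet> N (\<phi> y)) has_derivative D i) (at x)" if i: "i \<in> Basis" for i
    by (rule derivative_eq_intros U2[OF x i] DN[OF x] refl)+
      (use q in \<open>simp add: fun_eq_iff D_def grad_\<phi>_inner[OF x] field_simps\<close>)
  have deriv_grad: "(grad_t has_derivative (\<lambda>h. \<Sum>i\<in>Basis. D i h *\<^sub>R i)) (at x)"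
    unfolding grad_t_def[abs_def] by (intro has_derivative_sum has_derivative_scaleR_left D)
  have "(\<Sum>i\<in>Basis. (\<Sum>j\<in>Basis. D j i *\<^sub>R j) \<bullet> i) = (\<Sum>i\<in>Basis. D i i)"
    by (simp add: sum_over_Basis_inner)
  also have "\<dots> = lap_u x \<bullet> N (\<phi> x) - k (\<phi> x) * q x * (grad_\<phi> x \<bullet> grad_\<phi> x)"
    unfolding euclidean_inner[of "grad_\<phi> x" "grad_\<phi> x"] lap_u_def D_def
    by (simp add: sum_subtractf inner_sum_left sum_distrib_left mult_ac)
  finally have tr: "(\<Sum>i\<in>Basis. (\<Sum>j\<in>Basis. D j i *\<^sub>R j) \<bullet> i) =
    lap_u x \<bullet> N (\<phi> x) - k (\<phi> x) * q x * (grad_\<phi> x \<bullet> grad_\<phi> x)" .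
  show ?thesis by (rule exI, rule conjI, rule deriv_grad, rule tr)
qed

text \<open>
  In terms of the coefficients \<open>a\<close>, \<open>b\<close>, \<open>c\<close> of the energy, \<open>- 2 k / q = a\<^sub>t / a\<close>, \<open>t k' / q = b / a\<close>
  and \<open>k q = c\<close>. The terms in \<open>\<bar>\<nabla>\<phi>\<bar>\<^sup>2\<close> of \<open>\<sigma> \<Delta>\<phi> + m t \<Delta>t\<close> have the coefficient \<open>\<beta>\<close>, and
  with \<open>g = \<sigma> \<nabla>\<phi> + m t \<nabla>t\<close>
  one has \<open>\<bar>\<nabla>\<phi>\<bar>\<^sup>2 = g \<cdot> (\<sigma> \<nabla>\<phi> - m t \<nabla>t) + m\<^sup>2 t\<^sup>2 \<bar>\<nabla>t\<bar>\<^sup>2\<close>, whence the drift in the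
  conclusion. Adding it leaves exactly the reaction term and
  \<open>m \<bar>\<nabla>t\<bar>\<^sup>2\<close> times the quantity assumed nonnegative in the last hypothesis.
\<close>

lemma barrier_subsolution:
  assumes x: "x \<in> \<omega>" and \<sigma>: "\<sigma> * \<sigma> = (1::real)" and m: "m \<ge> 0"
    and reaction: "0 \<le> \<sigma> * (lap_u x \<bullet> T (\<phi> x)) / q x + m * t x * (lap_u x \<bullet> N (\<phi> x))"
    and \<beta>: "\<beta> = \<sigma> * (t x * k' (\<phi> x) / q x) - m * t x * (k (\<phi> x) * q x)"
    and small: "0 \<le> 1 - 2 * t x * (k (\<phi> x) / q x) + \<beta> * m * (t x)\<^sup>2"
  shows "\<exists>H. ((\<lambda>y. \<sigma> *\<^sub>R grad_\<phi> y + (m * t y) *\<^sub>R grad_t y) has_derivative H) (at x) \<and>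
    0 \<le> (\<Sum>i\<in>Basis. H i \<bullet> i) +
      ((- 2 * (k (\<phi> x) / q x)) *\<^sub>R grad_t x - \<beta> *\<^sub>R (\<sigma> *\<^sub>R grad_\<phi> x - (m * t x) *\<^sub>R grad_t x))
        \<bullet> (\<sigma> *\<^sub>R grad_\<phi> x + (m * t x) *\<^sub>R grad_t x)"
proof -
  obtain H\<phi> where H\<phi>: "(grad_\<phi> has_derivative H\<phi>) (at x)" "(\<Sum>i\<in>Basis. H\<phi> i \<bullet> i) =
      (lap_u x \<bullet> T (\<phi> x) + 2 * k (\<phi> x) * (grad_\<phi> x \<bullet> grad_t x) + t x * k' (\<phi> x) * (grad_\<phi> x \<bullet> grad_\<phi> x)) / q x"
    using divergence_grad_\<phi>[OF x] by (elim exE conjE)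
  obtain Ht where Ht: "(grad_t has_derivative Ht) (at x)" "(\<Sum>i\<in>Basis. Ht i \<bullet> i) =
      lap_u x \<bullet> N (\<phi> x) - k (\<phi> x) * q x * (grad_\<phi> x \<bullet> grad_\<phi> x)"
    using divergence_grad_t[OF x] by (elim exE conjE)
  define H where "H = (\<lambda>h. \<sigma> *\<^sub>R H\<phi> h + ((m * t x) *\<^sub>R Ht h + (m * (grad_t x \<bullet> h)) *\<^sub>R grad_t x))"
  have dH: "((\<lambda>y. \<sigma> *\<^sub>R grad_\<phi> y + (m * t y) *\<^sub>R grad_t y) has_derivative H) (at x)"
    unfolding H_def
    by (rule derivative_eq_intros H\<phi>(1) Ht(1) t_has_derivative[OF x] refl)+ simp
  have tr: "(\<Sum>i\<in>Basis. H i \<bullet> i) =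
      \<sigma> * (\<Sum>i\<in>Basis. H\<phi> i \<bullet> i) + m * t x * (\<Sum>i\<in>Basis. Ht i \<bullet> i) + m * (grad_t x \<bullet> grad_t x)"
    unfolding euclidean_inner[of "grad_t x" "grad_t x"] H_def
    by (simp add: inner_left_distrib sum.distrib sum_distrib_left mult_ac)
  have eq: "\<sigma> * (\<Sum>i\<in>Basis. H\<phi> i \<bullet> i) + m * t x * (\<Sum>i\<in>Basis. Ht i \<bullet> i) + m * (grad_t x \<bullet> grad_t x) +
       ((- 2 * (k (\<phi> x) / q x)) *\<^sub>R grad_t x - \<beta> *\<^sub>R (\<sigma> *\<^sub>R grad_\<phi> x - (m * t x) *\<^sub>R grad_t x))
        \<bullet> (\<sigma> *\<^sub>R grad_\<phi> x + (m * t x) *\<^sub>R grad_t x) =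
      (\<sigma> * (lap_u x \<bullet> T (\<phi> x)) / q x + m * t x * (lap_u x \<bullet> N (\<phi> x))) +
      m * (grad_t x \<bullet> grad_t x) * (1 - 2 * t x * (k (\<phi> x) / q x) + \<beta> * m * (t x)\<^sup>2)"
  proof -
    have ss: "\<sigma> * (\<sigma> * r) = r" for r using \<sigma> by (simp flip: mult.assoc)
    have exp: "((- 2 * (k (\<phi> x) / q x)) *\<^sub>R grad_t x - \<beta> *\<^sub>R (\<sigma> *\<^sub>R grad_\<phi> x - (m * t x) *\<^sub>R grad_t x))
        \<bullet> (\<sigma> *\<^sub>R grad_\<phi> x + (m * t x) *\<^sub>R grad_t x) =
      - 2 * (k (\<phi> x) / q x) * (\<sigma> * (grad_\<phi> x \<bullet> grad_t x) + m * t x * (grad_t x \<bullet> grad_t x))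
        - \<beta> * ((grad_\<phi> x \<bullet> grad_\<phi> x) - (m * t x)\<^sup>2 * (grad_t x \<bullet> grad_t x))"
      by (simp add: ss \<sigma> inner_diff_left inner_right_distrib inner_commute[of "grad_t x" "grad_\<phi> x"]
          algebra_simps power2_eq_square)
    show ?thesis
      unfolding exp H\<phi>(2) Ht(2) \<beta>
      by (simp add: ss inner_commute[of "grad_t x" "grad_\<phi> x"] algebra_simps power2_eq_square add_divide_distrib)
  qed
  have "0 \<le> (\<sigma> * (lap_u x \<bullet> T (\<phi> x)) / q x + m * t x * (lap_u x \<bullet> N (\<phi> x))) +
      m * (grad_t x \<bullet> grad_t x) * (1 - 2 * t x * (k (\<phi> x) / q x) + \<beta> * m * (t x)\<^sup>2)"
    by (rule add_nonneg_nonneg[OF reaction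
          mult_nonneg_nonneg[OF mult_nonneg_nonneg[OF m inner_ge_zero] small]])
  then show ?thesis
    by (intro exI[of _ H] conjI dH) (simp only: tr eq)
qed

lemma barrier_maximum_principle:
  assumes bdd: "bounded \<omega>" and cl: "continuous_on (closure \<omega>) \<phi>" "continuous_on (closure \<omega>) t"
    and \<sigma>: "\<sigma> * \<sigma> = (1::real)" and m: "m \<ge> 0"
    and reaction: "\<And>x. x \<in> \<omega> \<Longrightarrow>
      0 \<le> \<sigma> * (lap_u x \<bullet> T (\<phi> x)) / q x + m * t x * (lap_u x \<bullet> N (\<phi> x))"
    and small: "\<And>x. x \<in> \<omega> \<Longrightarrow> 0 \<le> 1 - 2 * t x * (k (\<phi> x) / q x) +
      (\<sigma> * (t x * k' (\<phi> x) / q x) - m * t x * (k (\<phi> x) * q x)) * m * (t x)\<^sup>2"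
    and x: "x \<in> closure \<omega>"
  shows "\<exists>y\<in>frontier \<omega>. \<sigma> * \<phi> x + m * (t x)\<^sup>2 / 2 \<le> \<sigma> * \<phi> y + m * (t y)\<^sup>2 / 2"
proof -
  have c: "continuous_on \<omega> (\<lambda>x. k (\<phi> x))"
    by (rule continuous_at_imp_continuous_on) (blast intro: has_derivative_continuous Dk)
  have c1: "continuous_on \<omega> q"
    by (rule continuous_at_imp_continuous_on) (blast intro: has_derivative_continuous q_has_derivative)
  have "isCont grad_\<phi> y \<and> isCont grad_t y" if "y \<in> \<omega>" for y
    using divergence_grad_\<phi>[OF that] divergence_grad_t[OF that] by (elim exE conjE) (simp add: has_derivative_continuous)
  then have c2: "continuous_on \<omega> grad_\<phi>" "continuous_on \<omega> grad_t"
    by (simp_all add: continuous_at_imp_continuous_on)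
  have c': "continuous_on \<omega> (\<lambda>x. k' (\<phi> x))"
    by (rule continuous_on_compose2[OF k' cont(1)]) auto
  show ?thesis
  proof (rule weak_maximum_principle[OF open_\<omega> bdd _ _ _ barrier_subsolution[OF _ \<sigma> m reaction refl small] x])
    show "continuous_on (closure \<omega>) (\<lambda>x. \<sigma> * \<phi> x + m * (t x)\<^sup>2 / 2)"
      by (intro continuous_intros cl) simp
    show "((\<lambda>x. \<sigma> * \<phi> x + m * (t x)\<^sup>2 / 2) has_derivative
        (\<lambda>h. (\<sigma> *\<^sub>R grad_\<phi> y + (m * t y) *\<^sub>R grad_t y) \<bullet> h)) (at y)" if "y \<in> \<omega>" for y
      by (auto intro!: derivative_eq_intros \<phi>_has_derivative[OF that] t_has_derivative[OF that]
          simp: fun_eq_iff inner_left_distrib)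
    show "continuous_on \<omega> (\<lambda>x. (- 2 * (k (\<phi> x) / q x)) *\<^sub>R grad_t x -
        (\<sigma> * (t x * k' (\<phi> x) / q x) - m * t x * (k (\<phi> x) * q x)) *\<^sub>R
          (\<sigma> *\<^sub>R grad_\<phi> x - (m * t x) *\<^sub>R grad_t x))"
      by (intro continuous_on_diff continuous_on_scaleR continuous_on_mult continuous_on_divide
          continuous_on_const c c1 c2 c' cont ballI q_nonzero)
  qed assumption+
qed

end

section \<open>The curve and its inward normal\<close>

lemma smooth_on_imp_differentiable: "smooth_on S f \<Longrightarrow> x \<in> S \<Longrightarrow> f differentiable (at x)"
  unfolding smooth_on_def by (metis Ck_on.simps(2))

lemma smooth_on_frechet_derivative:
  "smooth_on S f \<Longrightarrow> smooth_on S (\<lambda>x. frechet_derivative f (at x) v)"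
  unfolding smooth_on_def by (metis Ck_on.simps(2))

lemma smooth_on_imp_continuous_on: "smooth_on S f \<Longrightarrow> continuous_on S f"
  unfolding smooth_on_def by (metis Ck_on.simps(1))

lemma smooth_curve_derivative:
  fixes f :: "real \<Rightarrow> 'b::real_normed_vector"
  assumes "smooth_on UNIV f"
  shows "(f has_vector_derivative vector_derivative f (at s)) (at s)"
    and "smooth_on UNIV (\<lambda>s. vector_derivative f (at s))"
proof -
  have d: "f differentiable (at s)" for s using smooth_on_imp_differentiable[OF assms] by simp
  then show "(f has_vector_derivative vector_derivative f (at s)) (at s)"
    by (simp flip: vector_derivative_works)
  show "smooth_on UNIV (\<lambda>s. vector_derivative f (at s))"
    using smooth_on_frechet_derivative[OF assms, of 1] frechet_derivative_eq_vector_derivative[OF d]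
    by simp
qed

lemma gradient_inner:
  assumes "f differentiable (at x)"
  shows "gradient f x \<bullet> h = frechet_derivative f (at x) h"
  unfolding gradient_def using linear_frechet_derivative[OF assms] by (rule functional_eq_inner)

lemma range_cis: "range cis = sphere 0 1"
proof
  show "sphere 0 1 \<subseteq> range cis"
  proof
    fix z :: complex assume "z \<in> sphere 0 1"
    then have "norm z = 1" by simp
    then have "z = cis (Arg z)" using cis_Arg[of z] by (cases "z = 0") (auto simp: sgn_div_norm)
    then show "z \<in> range cis" by blast
  qed
qed auto

lemma parametrization_range:
  assumes "arc_length_parametrization \<tau> \<Gamma>"
  shows "\<Gamma> = range (\<lambda>s. \<tau> (cis s))"
proof -
  have "\<Gamma> = \<tau> ` range cis"
    using assms by (simp add: range_cis arc_length_parametrization_def bij_betw_def)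
  then show ?thesis by (simp add: image_image)
qed

lemma tangent_smooth:
  assumes "arc_length_parametrization \<tau> \<Gamma>"
  shows "((\<lambda>s. \<tau> (cis s)) has_vector_derivative tangent \<tau> s) (at s)"
    and "smooth_on UNIV (tangent \<tau>)"
  using smooth_curve_derivative[of "\<lambda>s. \<tau> (cis s)"] assms
  by (simp_all add: arc_length_parametrization_def tangent_def[abs_def])

text \<open>
  Both facts come from the Jordan curve theorem for \<open>x \<mapsto> \<tau> (cis (2 \<pi> x))\<close> on the unit interval, which
  is a simple closed path because \<open>\<tau>\<close> is injective on the circle.
\<close>

lemma closed_curve_compact_frontier:
  assumes "arc_length_parametrization \<tau> \<Gamma>"
  shows "compact \<Gamma>" and "frontier (outside \<Gamma>) = \<Gamma>"
proof -
  define g where "g = (\<lambda>x. \<tau> (cis (2 * pi * x)))"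
  have "continuous_on UNIV (\<lambda>s. \<tau> (cis s))"
    using assms smooth_on_imp_continuous_on by (auto simp: arc_length_parametrization_def)
  then have "path g"
    unfolding path_def g_def by (rule continuous_on_compose2) (auto intro!: continuous_intros)
  have inj: "inj_on \<tau> (sphere 0 1)"
    using assms by (auto simp: arc_length_parametrization_def bij_betw_def)
  have "x = y \<or> x = 0 \<and> y = 1 \<or> x = 1 \<and> y = 0"
    if "x \<in> {0..1}" "y \<in> {0..1}" "g x = g y" for x y :: real
  proof -
    have "cis (2 * pi * x) = cis (2 * pi * y)"
      using inj_onD[OF inj] that(3) by (simp add: g_def)
    then obtain j :: int where "2 * pi * x = 2 * pi * y + 2 * pi * j"
      using sin_cos_eq_iff[of "2 * pi * x" "2 * pi * y"] by (auto simp: complex_eq_iff)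
    then have "2 * pi * x = 2 * pi * (y + j)" by (simp add: algebra_simps)
    then have j: "x = y + j" by simp
    with that(1,2) have "-1 \<le> j" "j \<le> 1" by auto
    then have "j = -1 \<or> j = 0 \<or> j = 1" by linarith
    then show ?thesis using j that(1,2) by auto
  qed
  with \<open>path g\<close> have "simple_path g" unfolding simple_path_def loop_free_def by blast
  moreover have "pathfinish g = pathstart g"
    by (simp add: pathfinish_def pathstart_def g_def)
  moreover have im': "path_image g = \<Gamma>"
  proof -
    have "s \<in> range (\<lambda>s. \<tau> (cis s)) \<Longrightarrow> s \<in> path_image g" for s
    proof -
      assume "s \<in> range (\<lambda>s. \<tau> (cis s))"
      then obtain r where r: "s = \<tau> (cis r)" by blast
      have "2 * pi * frac (r / (2 * pi)) = r - 2 * pi * \<lfloor>r / (2 * pi)\<rfloor>"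
        by (simp add: frac_def field_simps)
      then have "cis r = cis (2 * pi * frac (r / (2 * pi)))"
        using cis_multiple_2pi[of "of_int \<lfloor>r / (2 * pi)\<rfloor>"] by (simp flip: cis_divide)
      then show "s \<in> path_image g"
        unfolding path_image_def g_def r
        by (intro image_eqI[of _ _ "frac (r / (2 * pi))"])
          (auto simp: frac_ge_0 frac_lt_1 less_imp_le)
    qed
    then show ?thesis
      using parametrization_range[OF assms] by (auto simp: path_image_def g_def)
  qed
  ultimately show "frontier (outside \<Gamma>) = \<Gamma>"
    using Jordan_inside_outside[of g] by simp
  show "compact \<Gamma>" using compact_path_image[OF \<open>path g\<close>] im' by simp
qed

lemma orthogonal_to_unit:
  fixes w z :: complex
  assumes "norm z = 1" "w \<bullet> z = 0"
  shows "w = (w \<bullet> (\<i> * z)) *\<^sub>R (\<i> * z)" and "norm w = \<bar>w \<bullet> (\<i> * z)\<bar>"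
proof -
  have z: "Re z * Re z + Im z * Im z = 1"
    using assms(1) by (simp add: cmod_def power2_eq_square)
  have o: "Re w * Re z + Im w * Im z = 0" using assms(2) by (simp add: inner_complex_def)
  have "Re w = Re ((w \<bullet> (\<i> * z)) *\<^sub>R (\<i> * z))" "Im w = Im ((w \<bullet> (\<i> * z)) *\<^sub>R (\<i> * z))"
    using z o by (simp_all add: inner_complex_def) algebra+
  then show eq: "w = (w \<bullet> (\<i> * z)) *\<^sub>R (\<i> * z)" by (simp add: complex_eq_iff)
  show "norm w = \<bar>w \<bullet> (\<i> * z)\<bar>"
    by (subst eq) (simp add: norm_mult assms(1))
qed

lemma inner_i_times: "(\<i> * z) \<bullet> z = 0" for z :: complex
  by (simp add: inner_complex_def)

text \<open>
  At each point the normal is one of \<open>\<plusminus> \<i> T\<close>, and the sign is to be shown constant. The half tubes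
  \<open>S e = {\<gamma> p + e r \<i> T p | 0 < r < \<delta>}\<close> for \<open>e = \<plusminus> 1\<close> are connected and miss \<open>\<Gamma>\<close>, so a half tube that
  the normal enters at a single point lies entirely inside \<open>\<Gamma>\<close>. If both signs occurred, both half
  tubes would be inside. But any point near \<open>\<Gamma>\<close> and off it lies in one of them, because the
  segment to a nearest point of the curve is orthogonal to the curve; then no point close to \<open>\<Gamma>\<close> would
  be outside, whereas \<open>\<Gamma>\<close> is the frontier of its outside.
\<close>

lemma normal_is_rotated_tangent:
  assumes curve: "arc_length_parametrization \<tau> \<Gamma>" and normal: "inward_unit_normal \<tau> \<Gamma> n"
    and \<delta>: "\<delta> > 0"
    and off: "\<And>p s. s \<noteq> 0 \<Longrightarrow> \<bar>s\<bar> < \<delta> \<Longrightarrow> from_coords \<tau> n p s \<notin> \<Gamma>"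
  obtains \<sigma> :: real where "\<sigma> * \<sigma> = 1" and "\<And>s. n (\<tau> (cis s)) = \<sigma> *\<^sub>R (\<i> * tangent \<tau> s)"
proof -
  define \<gamma> where "\<gamma> = (\<lambda>s. \<tau> (cis s))"
  define T where "T = tangent \<tau>"
  have \<Gamma>: "\<Gamma> = range \<gamma>" using parametrization_range[OF curve] by (simp add: \<gamma>_def)
  have D\<gamma>: "(\<gamma> has_vector_derivative T s) (at s)" for s
    using tangent_smooth(1)[OF curve] by (simp add: \<gamma>_def T_def)
  have T1: "norm (T s) = 1" for s
    using curve by (simp add: arc_length_parametrization_def T_def)
  have cont: "continuous_on UNIV \<gamma>" "continuous_on UNIV T"
    using curve smooth_on_imp_continuous_on tangent_smooth(2)[OF curve]
    by (auto simp: arc_length_parametrization_def \<gamma>_def T_def)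
  have pm: "\<exists>e\<in>{1, -1}. n (\<gamma> s) = e *\<^sub>R (\<i> * T s)" for s
  proof -
    have "norm (n (\<gamma> s)) = 1" "n (\<gamma> s) \<bullet> T s = 0"
      using normal by (auto simp: inward_unit_normal_def \<gamma>_def T_def)
    with orthogonal_to_unit[OF T1 this(2)]
    have "\<bar>n (\<gamma> s) \<bullet> (\<i> * T s)\<bar> = 1" "n (\<gamma> s) = (n (\<gamma> s) \<bullet> (\<i> * T s)) *\<^sub>R (\<i> * T s)"
      by auto
    then show ?thesis by (metis abs_eq_iff' insertCI abs_1)
  qed
  have fc: "from_coords \<tau> n p r = \<gamma> p + r *\<^sub>R n (\<gamma> p)" for p r
    by (simp add: from_coords_def \<gamma>_def)
  define S where "S = (\<lambda>e. (\<lambda>(p, r). \<gamma> p + (e * r) *\<^sub>R (\<i> * T p)) ` (UNIV \<times> {0<..<\<delta>}))"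
  have "connected (S e)" for e :: real
  proof -
    have "continuous_on (UNIV \<times> {0<..<\<delta>}) (\<lambda>z. \<gamma> (fst z) + (e * snd z) *\<^sub>R (\<i> * T (fst z)))"
      by (intro continuous_intros continuous_on_compose2[OF cont(1)] continuous_on_compose2[OF cont(2)]) auto
    then show ?thesis
      unfolding S_def case_prod_beta
      by (rule connected_continuous_image) (simp add: connected_Times convex_connected)
  qed
  have S\<Gamma>: "S e \<subseteq> - \<Gamma>" if e: "e \<in> {1, -1}" for e
  proof
    fix z assume "z \<in> S e"
    then obtain p r where z: "z = \<gamma> p + (e * r) *\<^sub>R (\<i> * T p)" "0 < r" "r < \<delta>"
      by (auto simp: S_def)
    obtain e' where e': "e' \<in> {1, -1}" "n (\<gamma> p) = e' *\<^sub>R (\<i> * T p)" using pm by blast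
    have "z = from_coords \<tau> n p (e * e' * r)"
      using e e' by (auto simp: z fc)
    then show "z \<in> - \<Gamma>" using off[of "e * e' * r" p] z e e' by auto
  qed
  have inside: "S e \<subseteq> inside \<Gamma>" if e: "e \<in> {1, -1}" and s: "n (\<gamma> s) = e *\<^sub>R (\<i> * T s)" for e s
  proof
    fix z assume z: "z \<in> S e"
    have "\<forall>\<^sub>F r in at_right 0. \<gamma> s + r *\<^sub>R n (\<gamma> s) \<in> inside \<Gamma>"
      using normal by (simp add: inward_unit_normal_def \<gamma>_def)
    moreover have "\<forall>\<^sub>F r in at_right 0. r \<in> {0<..<\<delta>}"
      using \<delta> by (rule eventually_at_right_real)
    ultimately have "\<forall>\<^sub>F r in at_right 0. \<gamma> s + r *\<^sub>R n (\<gamma> s) \<in> inside \<Gamma> \<and> r \<in> {0<..<\<delta>}"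
      by (rule eventually_conj)
    then obtain r where r: "\<gamma> s + r *\<^sub>R n (\<gamma> s) \<in> inside \<Gamma>" "r \<in> {0<..<\<delta>}"
      using eventually_happens'[OF trivial_limit_at_right_real] by blast
    have "\<gamma> s + r *\<^sub>R n (\<gamma> s) \<in> S e"
      unfolding S_def using r(2) s by (auto intro!: image_eqI[of _ _ "(s, r)"])
    then have "connected_component (- \<Gamma>) (\<gamma> s + r *\<^sub>R n (\<gamma> s)) z"
      using \<open>connected (S e)\<close> S\<Gamma>[OF e] z by (meson connected_component_def)
    then show "z \<in> inside \<Gamma>" using r(1) by (rule inside_same_component)
  qed
  have not_both: False if both: "S 1 \<subseteq> inside \<Gamma>" "S (-1) \<subseteq> inside \<Gamma>"
  proof -
    have "\<gamma> 0 \<in> closure (outside \<Gamma>)"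
      using closed_curve_compact_frontier(2)[OF curve] \<Gamma> by (auto simp: frontier_def)
    then obtain y where y: "y \<in> outside \<Gamma>" "dist y (\<gamma> 0) < \<delta>"
      using \<delta> by (auto simp: closure_approachable)
    have "\<Gamma> \<noteq> {}" using \<Gamma> by auto
    then obtain p where p: "p \<in> \<Gamma>" "\<And>q. q \<in> \<Gamma> \<Longrightarrow> dist y p \<le> dist y q"
      using distance_attains_inf[OF compact_imp_closed[OF closed_curve_compact_frontier(1)[OF curve]]] by metis
    then obtain s where s: "p = \<gamma> s" using \<Gamma> by blast
    define f where "f = (\<lambda>r. (y - \<gamma> r) \<bullet> (y - \<gamma> r))"
    have "(f has_derivative (\<lambda>h. - 2 * ((y - \<gamma> s) \<bullet> (h *\<^sub>R T s)))) (at s)"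
      unfolding f_def
      by (rule derivative_eq_intros D\<gamma>[unfolded has_vector_derivative_def] refl)+
        (simp add: fun_eq_iff inner_commute algebra_simps)
    moreover have "f s \<le> f r" for r
    proof -
      have "dist y (\<gamma> s) \<le> dist y (\<gamma> r)" using p(2) s \<Gamma> by blast
      then show ?thesis
        by (simp add: f_def dist_norm power_mono flip: power2_norm_eq_inner)
    qed
    ultimately have "(\<lambda>h. - 2 * ((y - \<gamma> s) \<bullet> (h *\<^sub>R T s))) = (\<lambda>h. 0)"
      by (intro differential_zero_maxmin[of s UNIV f]) auto
    from fun_cong[OF this, of 1] have orth: "(y - \<gamma> s) \<bullet> T s = 0" by simp
    define c where "c = (y - \<gamma> s) \<bullet> (\<i> * T s)"
    have c: "y - \<gamma> s = c *\<^sub>R (\<i> * T s)" "norm (y - \<gamma> s) = \<bar>c\<bar>"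
      using orthogonal_to_unit[OF T1 orth] by (auto simp: c_def)
    have "y \<notin> \<Gamma>" using y(1) outside_no_overlap[of \<Gamma>] by blast
    then have "y \<noteq> \<gamma> s" using p(1) s by blast
    then have "c \<noteq> 0" using c(2) by auto
    have "\<bar>c\<bar> < \<delta>"
      using c(2) p(2)[of "\<gamma> 0"] s y(2) \<Gamma> by (simp add: dist_norm)
    have "y \<in> S (sgn c)"
      unfolding S_def using c(1) \<open>c \<noteq> 0\<close> \<open>\<bar>c\<bar> < \<delta>\<close>
      by (intro image_eqI[of _ _ "(s, \<bar>c\<bar>)"]) (auto simp: abs_mult_sgn algebra_simps)
    then have "y \<in> inside \<Gamma>" using both \<open>c \<noteq> 0\<close> by (auto simp: sgn_if split: if_splits)
    then show False using y(1) inside_Int_outside by blast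
  qed
  obtain e where e: "e \<in> {1, -1}" "n (\<gamma> 0) = e *\<^sub>R (\<i> * T 0)" using pm by blast
  have "n (\<gamma> s) = e *\<^sub>R (\<i> * T s)" for s
  proof (rule ccontr)
    assume "n (\<gamma> s) \<noteq> e *\<^sub>R (\<i> * T s)"
    then have "n (\<gamma> s) = (- e) *\<^sub>R (\<i> * T s)" using pm[of s] e(1) by auto
    then have "S e \<subseteq> inside \<Gamma>" "S (- e) \<subseteq> inside \<Gamma>"
      using inside[of e 0] inside[of "- e" s] e by auto
    then show False using not_both e(1) by auto
  qed
  then show thesis using that[of e] e(1) by (auto simp: \<gamma>_def T_def)
qed

section \<open>The frame of the curve and the coefficients\<close>

text \<open>
  The curvature function is not assumed differentiable; it is, because it equals \<open>T' \<cdot> N\<close> and the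
  normal is a fixed rotation of the smooth tangent. Its derivative is \<open>T'' \<cdot> N\<close>.
\<close>

lemma moving_frame_of_curve:
  assumes curve: "arc_length_parametrization \<tau> \<Gamma>" and curvature: "signed_curvature \<tau> n \<kappa>"
    and \<sigma>: "\<sigma> * \<sigma> = (1::real)" and N: "\<And>s. n (\<tau> (cis s)) = \<sigma> *\<^sub>R (\<i> * tangent \<tau> s)"
  shows "\<exists>k'. moving_frame (\<lambda>s. \<tau> (cis s)) (tangent \<tau>) (\<lambda>s. n (\<tau> (cis s))) (\<lambda>s. \<kappa> (\<tau> (cis s))) k'"
proof -
  define T where "T = tangent \<tau>"
  define N where "N = (\<lambda>s. n (\<tau> (cis s)))"
  define k where "k = (\<lambda>s. \<kappa> (\<tau> (cis s)))"
  define T3 where "T3 = (\<lambda>s. vector_derivative (\<lambda>r. vector_derivative T (at r)) (at s))"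
  define k' where "k' = (\<lambda>s. T3 s \<bullet> N s)"
  have NT: "N s = \<sigma> *\<^sub>R (\<i> * T s)" for s using N by (simp add: N_def T_def)
  have norm_T: "norm (T s) = 1" for s
    using curve by (simp add: arc_length_parametrization_def T_def)
  have TT: "T s \<bullet> T s = 1" for s using norm_T by (simp add: norm_eq_1)
  have ii: "(\<i> * z) \<bullet> (\<i> * w) = z \<bullet> w" for z w by (simp add: inner_complex_def)
  have NN: "N s \<bullet> N s = 1" for s using TT \<sigma> by (simp add: NT ii)
  have TN: "T s \<bullet> N s = 0" for s by (simp add: NT inner_commute[of "T s"] inner_i_times)
  have smooth: "smooth_on UNIV T" using tangent_smooth(2)[OF curve] by (simp add: T_def)
  have DT: "(T has_vector_derivative k s *\<^sub>R N s) (at s)" for s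
    using curvature by (simp add: signed_curvature_def T_def k_def N_def)
  then have T2: "vector_derivative T (at s) = k s *\<^sub>R N s" for s
    by (rule vector_derivative_at)
  have smooth2: "smooth_on UNIV (\<lambda>s. k s *\<^sub>R N s)"
    using smooth_curve_derivative(2)[OF smooth] by (simp add: T2)
  have DkN: "((\<lambda>s. k s *\<^sub>R N s) has_vector_derivative T3 s) (at s)" for s
    using smooth_curve_derivative(1)[OF smooth2] by (simp add: T3_def T2)
  have contT3: "continuous_on UNIV T3"
    using smooth_on_imp_continuous_on[OF smooth_curve_derivative(2)[OF smooth2]]
    by (simp add: T3_def T2)
  have DN: "(N has_vector_derivative - k s *\<^sub>R T s) (at s)" for s
  proof -
    have D: "((\<lambda>s. \<sigma> *\<^sub>R (\<i> * T s)) has_vector_derivative \<sigma> *\<^sub>R (\<i> * (k s *\<^sub>R N s))) (at s)"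
      by (intro has_vector_derivative_scaleR has_vector_derivative_mult_right DT
          bounded_linear.has_vector_derivative[OF bounded_linear_scaleR_right])
    have eq: "\<sigma> *\<^sub>R (\<i> * (k s *\<^sub>R N s)) = - k s *\<^sub>R T s"
    proof -
      have "\<sigma> *\<^sub>R (\<i> * (k s *\<^sub>R N s)) = (\<sigma> * \<sigma>) *\<^sub>R (- k s *\<^sub>R T s)"
        by (simp add: NT complex_eq_iff)
      then show ?thesis using \<sigma> by simp
    qed
    have "(\<lambda>s. \<sigma> *\<^sub>R (\<i> * T s)) = N" using NT by (simp add: fun_eq_iff)
    then show ?thesis using D unfolding eq by (simp only:)
  qed
  have Dk: "(k has_real_derivative k' s) (at s)" for s
  proof -
    have "((\<lambda>s. (k s *\<^sub>R N s) \<bullet> N s) has_derivative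
        (\<lambda>h. (k s *\<^sub>R N s) \<bullet> (h *\<^sub>R (- k s *\<^sub>R T s)) + (h *\<^sub>R T3 s) \<bullet> N s)) (at s)"
      by (rule has_derivative_inner[OF DkN[unfolded has_vector_derivative_def]
            DN[unfolded has_vector_derivative_def]])
    moreover have "(\<lambda>s. (k s *\<^sub>R N s) \<bullet> N s) = k" by (simp add: NN)
    ultimately have "(k has_derivative (\<lambda>h. (k s *\<^sub>R N s) \<bullet> (h *\<^sub>R (- k s *\<^sub>R T s)) + (h *\<^sub>R T3 s) \<bullet> N s)) (at s)"
      by simp
    then show ?thesis
      by (rule has_derivative_imp_has_field_derivative)
        (simp add: k'_def TN inner_commute[of "N s" "T s"])
  qed
  have "continuous_on UNIV N"
    using DN by (intro continuous_at_imp_continuous_on) (blast intro: has_vector_derivative_continuous)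
  then have "continuous_on UNIV k'"
    unfolding k'_def by (intro continuous_on_inner contT3)
  then have "moving_frame (\<lambda>s. \<tau> (cis s)) T N k k'"
    using tangent_smooth(1)[OF curve]
    by (intro moving_frame.intro DT DN Dk TT NN TN) (simp_all add: T_def)
  then show ?thesis unfolding T_def N_def k_def by blast
qed

text \<open>
  With \<open>a = (1 - s k)\<^sup>2\<close> the bounded quantity is \<open>a\<^sub>t / a = - 2 k / (1 - s k)\<close>. If \<open>1 - s k\<close> were
  nonpositive, the zero \<open>1 / k\<close> of this factor would lie within the range \<open>\<bar>s\<bar> \<le> \<delta>\<close>, and just
  before that zero the quotient is arbitrarily large. At the zero itself it has the default value \<open>0\<close>, so
  the contradiction has to come from nearby points.
\<close>

lemma no_focal_point:
  fixes k \<delta> C s :: real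
  assumes bound: "\<And>s. \<bar>s\<bar> \<le> \<delta> \<Longrightarrow> \<bar>- 2 * k * (1 - s * k) / (1 - s * k)\<^sup>2\<bar> \<le> C"
    and s: "\<bar>s\<bar> \<le> \<delta>"
  shows "0 < 1 - s * k"
proof (rule ccontr)
  assume "\<not> 0 < 1 - s * k"
  then have sk: "1 \<le> s * k" by simp
  then have k: "k \<noteq> 0" by auto
  have "C \<ge> 0" using bound[OF s] by linarith
  \<comment> \<open>Prescribe \<open>1 - r k = \<eta>\<close>, with \<open>\<eta>\<close> so small that \<open>2 \<bar>k\<bar> / \<eta> > C\<close>.\<close>
  define \<eta> where "\<eta> = \<bar>k\<bar> / (\<bar>k\<bar> + C + 1)"
  have \<eta>: "0 < \<eta>" "\<eta> < 1" using k \<open>C \<ge> 0\<close> by (auto simp: \<eta>_def field_simps)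
  define r where "r = (1 - \<eta>) / k"
  have rk: "1 - r * k = \<eta>" using k by (simp add: r_def)
  have "\<bar>r * k\<bar> \<le> \<bar>s * k\<bar>" using rk \<eta> sk by linarith
  then have "\<bar>r\<bar> \<le> \<delta>" using k s by (simp add: abs_mult)
  from bound[OF this] have "2 * \<bar>k\<bar> / \<eta> \<le> C"
    using \<eta> unfolding rk by (simp add: abs_mult power2_eq_square)
  moreover have "2 * \<bar>k\<bar> / \<eta> = 2 * (\<bar>k\<bar> + C + 1)"
    using k by (simp add: \<eta>_def)
  ultimately show False using \<open>C \<ge> 0\<close> by simp
qed

context moving_frame
begin

text \<open>
  The two components of the gradient of \<open>W\<close> along the frame are read off by differentiating
  \<open>W = \<alpha> s\<^sup>2\<close> in the coordinates; the Jacobian appears in the tangential one.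
\<close>

lemma potential_derivatives:
  fixes W :: "'b \<Rightarrow> real" and \<alpha> :: "real \<Rightarrow> real \<Rightarrow> real"
  assumes W: "(W has_derivative W') (at (\<gamma> p + s *\<^sub>R N p))"
    and s: "\<bar>s\<bar> < \<delta>"
    and \<alpha>: "(\<lambda>z. \<alpha> (fst z) (snd z)) differentiable (at (p, s))"
    and eq: "\<And>p s. \<bar>s\<bar> < \<delta> \<Longrightarrow> W (\<gamma> p + s *\<^sub>R N p) = \<alpha> p s * s\<^sup>2"
  shows "(1 - s * k p) * W' (T p) = D\<^sub>\<phi> \<alpha> p s * s\<^sup>2"
    and "W' (N p) = D\<^sub>t \<alpha> p s * s\<^sup>2 + 2 * \<alpha> p s * s"
proof -
  have lin: "linear W'" using W by (rule has_derivative_linear)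
  obtain A where A: "((\<lambda>z. \<alpha> (fst z) (snd z)) has_derivative A) (at (p, s))"
    using \<alpha> unfolding differentiable_def by blast
  have "((\<lambda>r. (r, s)) has_derivative (\<lambda>h. (h, 0))) (at p)"
    by (auto intro!: derivative_eq_intros)
  from has_derivative_compose[OF this A]
  have "(\<lambda>r. \<alpha> r s) differentiable (at p)" unfolding differentiable_def by auto
  then have Dp: "((\<lambda>r. \<alpha> r s) has_real_derivative D\<^sub>\<phi> \<alpha> p s) (at p)"
    by (simp add: D\<^sub>\<phi>_def DERIV_deriv_iff_real_differentiable)
  have "((\<lambda>r. (p, r)) has_derivative (\<lambda>h. (0, h))) (at s)"
    by (auto intro!: derivative_eq_intros)
  from has_derivative_compose[OF this A]
  have "(\<lambda>r. \<alpha> p r) differentiable (at s)" unfolding differentiable_def by auto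
  then have Ds: "((\<lambda>r. \<alpha> p r) has_real_derivative D\<^sub>t \<alpha> p s) (at s)"
    by (simp add: D\<^sub>t_def DERIV_deriv_iff_real_differentiable)
  have "((\<lambda>r. \<gamma> r + s *\<^sub>R N r) has_derivative (\<lambda>h. h *\<^sub>R T p + s *\<^sub>R (h *\<^sub>R (- k p *\<^sub>R T p)))) (at p)"
    by (intro has_derivative_add has_derivative_scaleR_right
        \<gamma>[unfolded has_vector_derivative_def] N[unfolded has_vector_derivative_def])
  from has_derivative_compose[OF this W]
  have "((\<lambda>r. W (\<gamma> r + s *\<^sub>R N r)) has_real_derivative (1 - s * k p) * W' (T p)) (at p)"
    by (rule has_derivative_imp_has_field_derivative)
      (simp add: linear_diff[OF lin] linear_cmul[OF lin] algebra_simps)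
  moreover have "((\<lambda>r. W (\<gamma> r + s *\<^sub>R N r)) has_real_derivative D\<^sub>\<phi> \<alpha> p s * s\<^sup>2) (at p)"
    unfolding eq[OF s] by (rule DERIV_cmult_right[OF Dp])
  ultimately show "(1 - s * k p) * W' (T p) = D\<^sub>\<phi> \<alpha> p s * s\<^sup>2" by (rule DERIV_unique)
  have "((\<lambda>r. \<gamma> p + r *\<^sub>R N p) has_derivative (\<lambda>h. h *\<^sub>R N p)) (at s)"
    by (auto intro!: derivative_eq_intros)
  from has_derivative_compose[OF this W]
  have "((\<lambda>r. W (\<gamma> p + r *\<^sub>R N p)) has_real_derivative W' (N p)) (at s)"
    by (rule has_derivative_imp_has_field_derivative) (simp add: linear_cmul[OF lin])
  moreover have "((\<lambda>r. W (\<gamma> p + r *\<^sub>R N p)) has_real_derivative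
      D\<^sub>t \<alpha> p s * s\<^sup>2 + 2 * \<alpha> p s * s) (at s)"
  proof (rule has_field_derivative_transform_within_open)
    show "((\<lambda>r. \<alpha> p r * r\<^sup>2) has_real_derivative D\<^sub>t \<alpha> p s * s\<^sup>2 + 2 * \<alpha> p s * s) (at s)"
      by (auto intro!: derivative_eq_intros Ds)
    show "open {-\<delta><..<\<delta>}" "s \<in> {-\<delta><..<\<delta>}" using s by auto
    show "\<alpha> p r * r\<^sup>2 = W (\<gamma> p + r *\<^sub>R N p)" if "r \<in> {-\<delta><..<\<delta>}" for r
      using that by (intro eq[symmetric]) auto
  qed
  ultimately show "W' (N p) = D\<^sub>t \<alpha> p s * s\<^sup>2 + 2 * \<alpha> p s * s" by (rule DERIV_unique)
qed

end

lemma coefficient_formulas: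
  assumes "((\<lambda>s. \<kappa> (\<tau> (cis s))) has_real_derivative k') (at p)"
  shows "D\<^sub>t (coeff_a \<tau> \<kappa>) p s = - 2 * \<kappa> (\<tau> (cis p)) * (1 - s * \<kappa> (\<tau> (cis p)))"
    and "coeff_c \<tau> \<kappa> p s = \<kappa> (\<tau> (cis p)) * (1 - s * \<kappa> (\<tau> (cis p)))"
    and "coeff_b \<tau> \<kappa> p s = s * k' * (1 - s * \<kappa> (\<tau> (cis p)))"
proof -
  show Dt: "D\<^sub>t (coeff_a \<tau> \<kappa>) p s = - 2 * \<kappa> (\<tau> (cis p)) * (1 - s * \<kappa> (\<tau> (cis p)))"
    unfolding D\<^sub>t_def coeff_a_def
    by (rule DERIV_imp_deriv) (auto intro!: derivative_eq_intros)
  then show "coeff_c \<tau> \<kappa> p s = \<kappa> (\<tau> (cis p)) * (1 - s * \<kappa> (\<tau> (cis p)))"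
    by (simp add: coeff_c_def)
  have "D\<^sub>\<phi> (coeff_a \<tau> \<kappa>) p s = - 2 * s * k' * (1 - s * \<kappa> (\<tau> (cis p)))"
    unfolding D\<^sub>\<phi>_def coeff_a_def
    by (rule DERIV_imp_deriv) (auto intro!: derivative_eq_intros assms)
  then show "coeff_b \<tau> \<kappa> p s = s * k' * (1 - s * \<kappa> (\<tau> (cis p)))"
    by (simp add: coeff_b_def)
qed

section \<open>The maximum principle for the barriers\<close>

text \<open>
  Applied with \<open>x = \<alpha>\<^sub>\<phi> / a\<close> and \<open>y = 2 \<alpha> + \<alpha>\<^sub>t s\<close>: the good term is at least
  \<open>m c\<^sub>1 s\<^sup>2 \<ge> c\<^sub>5 s\<^sup>2\<close>.
\<close>

lemma reaction_term_nonneg: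
  fixes \<sigma> s c\<^sub>1 c\<^sub>5 m :: real
  assumes \<sigma>: "\<sigma> * \<sigma> = 1" and "c\<^sub>1 > 0" "m \<ge> 0" and m: "c\<^sub>5 / c\<^sub>1 \<le> m"
    and x: "\<bar>x\<bar> \<le> c\<^sub>5" and y: "c\<^sub>1 \<le> y"
  shows "0 \<le> \<sigma> * (x * s\<^sup>2) + m * (y * s\<^sup>2)"
proof -
  have "\<bar>\<sigma>\<bar> = 1" using \<sigma> by (metis abs_1 abs_eq_iff abs_square_eq_1 power2_eq_square)
  then have "\<bar>\<sigma> * x\<bar> \<le> c\<^sub>5" using x by (simp add: abs_mult)
  moreover have "c\<^sub>5 \<le> m * c\<^sub>1" using m \<open>c\<^sub>1 > 0\<close> by (simp add: field_simps)
  moreover have "m * c\<^sub>1 \<le> m * y" using y \<open>m \<ge> 0\<close> by (rule mult_left_mono)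
  ultimately have "0 \<le> \<sigma> * x + m * y" by linarith
  then have "0 \<le> (\<sigma> * x + m * y) * s\<^sup>2" by simp
  then show ?thesis by (simp add: algebra_simps)
qed

text \<open>
  Applied with \<open>z = k / q = - a\<^sub>t / (2 a)\<close>, with \<open>b\<close> standing for the quotient \<open>b / a\<close>, and \<open>c\<close>. The
  power \<open>\<delta>\<^sub>1\<^sup>3\<close> in the smallness condition arises because \<open>b / a\<close> vanishes linearly in \<open>s\<close>.
\<close>

lemma gradient_term_nonneg:
  fixes s :: real
  assumes \<sigma>: "\<sigma> * \<sigma> = (1::real)" and m: "m \<ge> 0" and c: "c\<^sub>2 > 0" "c\<^sub>3 > 0" "c\<^sub>4 > 0"
    and s: "\<bar>s\<bar> \<le> \<delta>\<^sub>1"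
    and z: "\<bar>z\<bar> \<le> c\<^sub>4" and b: "\<bar>b\<bar> \<le> c\<^sub>3 * \<bar>s\<bar>" and c2: "\<bar>c\<bar> \<le> c\<^sub>2"
    and small: "2 * c\<^sub>4 * \<delta>\<^sub>1 + m * (m * c\<^sub>2 + c\<^sub>3) * \<delta>\<^sub>1 ^ 3 < 1"
  shows "0 \<le> 1 - 2 * s * z + (\<sigma> * b - m * s * c) * m * s\<^sup>2"
proof -
  have \<sigma>1: "\<bar>\<sigma>\<bar> = 1" using \<sigma> by (metis abs_1 abs_eq_iff abs_square_eq_1 power2_eq_square)
  have "\<bar>s * z\<bar> \<le> \<delta>\<^sub>1 * c\<^sub>4"
    unfolding abs_mult using s z by (intro mult_mono) auto
  moreover have "\<bar>(\<sigma> * b - m * s * c) * m * s\<^sup>2\<bar> \<le> m * (m * c\<^sub>2 + c\<^sub>3) * \<delta>\<^sub>1 ^ 3"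
  proof -
    have "\<bar>m * s * c\<bar> \<le> m * \<bar>s\<bar> * c\<^sub>2"
      unfolding abs_mult using m c2 by (intro mult_mono) auto
    then have "\<bar>\<sigma> * b - m * s * c\<bar> \<le> c\<^sub>3 * \<bar>s\<bar> + m * \<bar>s\<bar> * c\<^sub>2"
      using b \<sigma>1 abs_triangle_ineq4[of "\<sigma> * b" "m * s * c"] by (simp add: abs_mult)
    then have "\<bar>\<sigma> * b - m * s * c\<bar> * (m * s\<^sup>2) \<le> (c\<^sub>3 * \<bar>s\<bar> + m * \<bar>s\<bar> * c\<^sub>2) * (m * s\<^sup>2)"
      using m by (intro mult_right_mono) auto
    also have "\<dots> = m * (m * c\<^sub>2 + c\<^sub>3) * \<bar>s\<bar> ^ 3"
      by (simp add: algebra_simps power3_eq_cube power2_eq_square)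
    also have "\<dots> \<le> m * (m * c\<^sub>2 + c\<^sub>3) * \<delta>\<^sub>1 ^ 3"
      using m c s by (intro mult_left_mono power_mono) auto
    finally show ?thesis using m by (simp add: abs_mult mult.assoc)
  qed
  ultimately show ?thesis using small by (simp add: abs_le_iff mult.assoc mult.commute[of c\<^sub>4])
qed

lemma maximum_on_frontier:
  fixes f :: "'a::euclidean_space \<Rightarrow> real"
  assumes \<omega>: "bounded \<omega>" "\<omega> \<noteq> {}" and f: "continuous_on (closure \<omega>) f"
    and le: "\<And>x. x \<in> closure \<omega> \<Longrightarrow> \<exists>y\<in>frontier \<omega>. f x \<le> f y"
  shows "\<exists>v. has_maximum_on f (closure \<omega>) v \<and> has_maximum_on f (frontier \<omega>) v"
proof -
  have fr: "frontier \<omega> \<subseteq> closure \<omega>" by (auto simp: frontier_def)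
  obtain x where x: "x \<in> closure \<omega>" "\<And>y. y \<in> closure \<omega> \<Longrightarrow> f y \<le> f x"
    using continuous_attains_sup[OF _ _ f] \<omega> by (auto simp: compact_closure)
  obtain z where z: "z \<in> frontier \<omega>" "f x \<le> f z" using le[OF x(1)] by blast
  have "f y \<le> f z" if "y \<in> closure \<omega>" for y using x(2)[OF that] z(2) by linarith
  then show ?thesis
    using z(1) fr unfolding has_maximum_on_def by (intro exI[of _ "f z"]) auto
qed

lemma minimum_on_iff: "has_minimum_on f S v \<longleftrightarrow> has_maximum_on (\<lambda>x. - f x) S (- v)"
  by (auto simp: has_minimum_on_def has_maximum_on_def)

theorem proposition2p1:
  fixes \<Gamma> \<omega> :: "complex set"
    and \<tau> n u :: "complex \<Rightarrow> complex"
    and W \<kappa> t \<phi> :: "complex \<Rightarrow> real"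
    and \<alpha> :: "real \<Rightarrow> real \<Rightarrow> real"
    and \<delta>\<^sub>\<Gamma> \<delta>\<^sub>0 \<delta>\<^sub>1 c\<^sub>0 c\<^sub>1 c\<^sub>2 c\<^sub>3 c\<^sub>4 c\<^sub>5 m \<epsilon> :: real
  assumes curve: "arc_length_parametrization \<tau> \<Gamma>"
    and potential: "admissible_potential \<Gamma> W"
    and normal: "inward_unit_normal \<tau> \<Gamma> n"
    and curvature: "signed_curvature \<tau> n \<kappa>"
    and "\<delta>\<^sub>\<Gamma> > 0" and projection: "smooth_projection_within \<Gamma> \<delta>\<^sub>\<Gamma>"
    and factor: "potential_factor \<tau> n W \<delta>\<^sub>\<Gamma> \<alpha>"
    and "0 < \<delta>\<^sub>0" "\<delta>\<^sub>0 < \<delta>\<^sub>\<Gamma>"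
    and "c\<^sub>0 > 0" "c\<^sub>1 > 0" "c\<^sub>2 > 0" "c\<^sub>3 > 0" "c\<^sub>4 > 0" "c\<^sub>5 > 0"
    and c0: "\<And>p s. \<bar>s\<bar> \<le> \<delta>\<^sub>0 \<Longrightarrow> \<bar>1 - coeff_a \<tau> \<kappa> p s\<bar> \<le> c\<^sub>0 * \<bar>s\<bar>"
    and c1: "\<And>p s. \<bar>s\<bar> \<le> \<delta>\<^sub>0 \<Longrightarrow> 2 * \<alpha> p s - \<bar>D\<^sub>t \<alpha> p s * s\<bar> \<ge> c\<^sub>1"
    and c2: "\<And>p s. \<bar>s\<bar> \<le> \<delta>\<^sub>0 \<Longrightarrow> \<bar>coeff_c \<tau> \<kappa> p s\<bar> \<le> c\<^sub>2"
    and c3: "\<And>p s. \<bar>s\<bar> \<le> \<delta>\<^sub>0 \<Longrightarrow> \<bar>coeff_b \<tau> \<kappa> p s / coeff_a \<tau> \<kappa> p s\<bar> \<le> c\<^sub>3 * \<bar>s\<bar>"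
    and c4: "\<And>p s. \<bar>s\<bar> \<le> \<delta>\<^sub>0 \<Longrightarrow> \<bar>D\<^sub>t (coeff_a \<tau> \<kappa>) p s / coeff_a \<tau> \<kappa> p s\<bar> \<le> 2 * c\<^sub>4"
    and c5: "\<And>p s. \<bar>s\<bar> \<le> \<delta>\<^sub>0 \<Longrightarrow> \<bar>D\<^sub>\<phi> \<alpha> p s / coeff_a \<tau> \<kappa> p s\<bar> \<le> c\<^sub>5"
    and "m > 0" and "0 < \<delta>\<^sub>1" "\<delta>\<^sub>1 < \<delta>\<^sub>0"
    and "c\<^sub>5 / c\<^sub>1 \<le> m"
    and "2 * c\<^sub>4 * \<delta>\<^sub>1 + m * (m * c\<^sub>2 + c\<^sub>3) * \<delta>\<^sub>1 ^ 3 < 1"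
    and "\<epsilon> > 0"
    and domain: "open \<omega>" "\<omega> \<noteq> {}" "connected \<omega>" "bounded \<omega>" "simply_connected \<omega>"
    and critical: "critical_point_on \<omega> W \<epsilon> u"
    and "continuous_on (closure \<omega>) u"
    and "\<And>x. x \<in> closure \<omega> \<Longrightarrow> infdist (u x) \<Gamma> \<le> \<delta>\<^sub>1"
    and "continuous_on (closure \<omega>) t" and "continuous_on (closure \<omega>) \<phi>"
    and "\<And>x. x \<in> closure \<omega> \<Longrightarrow> \<bar>t x\<bar> \<le> \<delta>\<^sub>1"
    and "\<And>x. x \<in> closure \<omega> \<Longrightarrow> u x = from_coords \<tau> n (\<phi> x) (t x)"
  shows "(\<exists>v. has_minimum_on (\<lambda>x. \<phi> x - m * (t x)\<^sup>2 / 2) (closure \<omega>) v \<and>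
              has_minimum_on (\<lambda>x. \<phi> x - m * (t x)\<^sup>2 / 2) (frontier \<omega>) v) \<and>
         (\<exists>v. has_maximum_on (\<lambda>x. \<phi> x + m * (t x)\<^sup>2 / 2) (closure \<omega>) v \<and>
              has_maximum_on (\<lambda>x. \<phi> x + m * (t x)\<^sup>2 / 2) (frontier \<omega>) v)"
proof -
  note t_bound = \<open>\<And>x. x \<in> closure \<omega> \<Longrightarrow> \<bar>t x\<bar> \<le> \<delta>\<^sub>1\<close>
    and u_coords = \<open>\<And>x. x \<in> closure \<omega> \<Longrightarrow> u x = from_coords \<tau> n (\<phi> x) (t x)\<close>
    and cont_coords = \<open>continuous_on (closure \<omega>) \<phi>\<close> \<open>continuous_on (closure \<omega>) t\<close>
  define \<gamma> where "\<gamma> = (\<lambda>s. \<tau> (cis s))"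
  define T where "T = tangent \<tau>"
  define N where "N = (\<lambda>s. n (\<tau> (cis s)))"
  define k where "k = (\<lambda>s. \<kappa> (\<tau> (cis s)))"
  have fc: "from_coords \<tau> n p s = \<gamma> p + s *\<^sub>R N p" for p s
    by (simp add: from_coords_def \<gamma>_def N_def)
  have W_eq: "W (\<gamma> p + s *\<^sub>R N p) = \<alpha> p s * s\<^sup>2" if "\<bar>s\<bar> < \<delta>\<^sub>\<Gamma>" for p s
    using factor that by (simp add: potential_factor_def fc)
  \<comment> \<open>The potential vanishes on \<open>\<Gamma>\<close>, but not at these points.\<close>
  have off: "from_coords \<tau> n p s \<notin> \<Gamma>" if "s \<noteq> 0" "\<bar>s\<bar> < \<delta>\<^sub>\<Gamma>" for p s
  proof -
    have "\<alpha> p s > 0" using factor that(2) by (simp add: potential_factor_def)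
    then have "W (from_coords \<tau> n p s) > 0" using W_eq[OF that(2)] that(1) by (simp add: fc)
    then show ?thesis using potential by (auto simp: admissible_potential_def)
  qed
  obtain s\<^sub>0 :: real where "s\<^sub>0 * s\<^sub>0 = 1" "\<And>s. n (\<tau> (cis s)) = s\<^sub>0 *\<^sub>R (\<i> * tangent \<tau> s)"
    using normal_is_rotated_tangent[OF curve normal \<open>\<delta>\<^sub>\<Gamma> > 0\<close> off] by blast
  then obtain k' where "moving_frame (\<lambda>s. \<tau> (cis s)) (tangent \<tau>) (\<lambda>s. n (\<tau> (cis s))) (\<lambda>s. \<kappa> (\<tau> (cis s))) k'"
    using moving_frame_of_curve[OF curve curvature] by blast
  then have frame: "moving_frame \<gamma> T N k k'" by (simp add: \<gamma>_def T_def N_def k_def)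
  then interpret moving_frame \<gamma> T N k k' .
  have Dk: "((\<lambda>s. \<kappa> (\<tau> (cis s))) has_real_derivative k' p) (at p)" for p
    using k by (simp add: k_def)
  note coeffs = coefficient_formulas[of \<kappa> \<tau>, OF Dk, folded fun_cong[OF k_def]]
  have a: "coeff_a \<tau> \<kappa> p s = (1 - s * k p)\<^sup>2" for p s by (simp add: coeff_a_def k_def)
  have q_pos: "0 < 1 - s * k p" if "\<bar>s\<bar> \<le> \<delta>\<^sub>0" for p s
    using no_focal_point[of \<delta>\<^sub>0 "k p" "2 * c\<^sub>4" s] c4[of _ p] that by (simp add: coeffs a)
  have closure: "\<omega> \<subseteq> closure \<omega>" by (rule closure_subset)
  have t_le: "\<bar>t x\<bar> \<le> \<delta>\<^sub>0" "\<bar>t x\<bar> < \<delta>\<^sub>\<Gamma>" if "x \<in> \<omega>" for x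
    using t_bound[of x] closure that \<open>\<delta>\<^sub>1 < \<delta>\<^sub>0\<close> \<open>\<delta>\<^sub>0 < \<delta>\<^sub>\<Gamma>\<close> by fastforce+
  define U where "U = (\<lambda>x. frechet_derivative u (at x))"
  define U2 where "U2 = (\<lambda>x i. frechet_derivative (\<lambda>y. U y i) (at x))"
  have u2: "Ck_on (Suc (Suc 0)) \<omega> u"
    using critical by (simp add: critical_point_on_def numeral_2_eq_2)
  interpret normal_coordinates \<gamma> T N k k' \<omega> u U U2 \<phi> t
  proof
    show "open \<omega>" by fact
    show "(u has_derivative U x) (at x)" if "x \<in> \<omega>" for x
      using u2 that by (simp add: U_def flip: frechet_derivative_works)
    show "((\<lambda>y. U y i) has_derivative U2 x i) (at x)" if "x \<in> \<omega>" "i \<in> Basis" for x i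
      using u2 that by (simp add: U_def U2_def flip: frechet_derivative_works)
    show "continuous_on \<omega> \<phi>" "continuous_on \<omega> t"
      using cont_coords closure by (auto intro: continuous_on_subset)
    show "u x = \<gamma> (\<phi> x) + t x *\<^sub>R N (\<phi> x)" if "x \<in> \<omega>" for x
      using u_coords[of x] closure that by (auto simp: fc)
    show "1 - t x * k (\<phi> x) \<noteq> 0" if "x \<in> \<omega>" for x
      using q_pos[OF t_le(1)[OF that], of "\<phi> x"] by simp
  qed
  have lap_u: "lap_u x = (1 / \<epsilon>\<^sup>2) *\<^sub>R gradient W (u x)" if "x \<in> \<omega>" for x
  proof -
    have "lap_u x = laplacian u x"
      unfolding lap_u_def laplacian_def by (simp add: U_def U2_def)
    then show ?thesis using critical that by (simp add: critical_point_on_def)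
  qed
  have W_diff: "W differentiable (at z)" for z
    using potential smooth_on_imp_differentiable[of UNIV W] by (simp add: admissible_potential_def)
  have \<alpha>_diff: "(\<lambda>z. \<alpha> (fst z) (snd z)) differentiable (at (p, s))" if "\<bar>s\<bar> < \<delta>\<^sub>\<Gamma>" for p s
  proof -
    have "smooth_on (UNIV \<times> {-\<delta>\<^sub>\<Gamma><..<\<delta>\<^sub>\<Gamma>}) (\<lambda>(p, s). \<alpha> p s)"
      using factor by (simp add: potential_factor_def)
    then have "(\<lambda>(p, s). \<alpha> p s) differentiable (at (p, s))"
      by (rule smooth_on_imp_differentiable) (use that in auto)
    then show ?thesis by (simp add: case_prod_unfold)
  qed
  have reaction: "0 \<le> \<sigma> * (lap_u x \<bullet> T (\<phi> x)) / q x + m * t x * (lap_u x \<bullet> N (\<phi> x))"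
    if \<sigma>: "\<sigma> * \<sigma> = 1" and x: "x \<in> \<omega>" for \<sigma> x
  proof -
    note pot = potential_derivatives[OF _ t_le(2)[OF x] \<alpha>_diff[OF t_le(2)[OF x]] W_eq,
        OF W_diff[unfolded frechet_derivative_works], of "\<phi> x"]
    have q: "q x > 0" using q_pos[OF t_le(1)[OF x], of "\<phi> x"] by (simp add: q_def)
    have ux: "gradient W (u x) \<bullet> h = frechet_derivative W (at (\<gamma> (\<phi> x) + t x *\<^sub>R N (\<phi> x))) h" for h
      using gradient_inner[OF W_diff] coords[OF x] by simp
    define X where "X = D\<^sub>\<phi> \<alpha> (\<phi> x) (t x) / coeff_a \<tau> \<kappa> (\<phi> x) (t x)"
    define Y where "Y = 2 * \<alpha> (\<phi> x) (t x) + D\<^sub>t \<alpha> (\<phi> x) (t x) * t x"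
    have X: "lap_u x \<bullet> T (\<phi> x) / q x = 1 / \<epsilon>\<^sup>2 * (X * (t x)\<^sup>2)"
    proof -
      have "q x * (gradient W (u x) \<bullet> T (\<phi> x)) = D\<^sub>\<phi> \<alpha> (\<phi> x) (t x) * (t x)\<^sup>2"
        using pot(1) by (simp add: ux q_def)
      then have eq: "gradient W (u x) \<bullet> T (\<phi> x) / q x = X * (t x)\<^sup>2"
        using q by (simp add: X_def a power2_eq_square field_simps flip: q_def)
      show ?thesis unfolding lap_u[OF x] eq[symmetric] by simp
    qed
    have Y: "t x * (lap_u x \<bullet> N (\<phi> x)) = 1 / \<epsilon>\<^sup>2 * (Y * (t x)\<^sup>2)"
    proof -
      have "t x * (gradient W (u x) \<bullet> N (\<phi> x)) = Y * (t x)\<^sup>2"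
        using pot(2) by (simp add: ux Y_def power2_eq_square algebra_simps)
      then show ?thesis unfolding lap_u[OF x] by simp
    qed
    have "\<bar>X\<bar> \<le> c\<^sub>5" "c\<^sub>1 \<le> Y"
      using c1[OF t_le(1)[OF x], of "\<phi> x"] c5[OF t_le(1)[OF x], of "\<phi> x"]
      by (auto simp: X_def Y_def)
    then have "0 \<le> \<sigma> * (X * (t x)\<^sup>2) + m * (Y * (t x)\<^sup>2)"
      using \<open>m > 0\<close> by (intro reaction_term_nonneg[OF \<sigma> \<open>c\<^sub>1 > 0\<close> _ \<open>c\<^sub>5 / c\<^sub>1 \<le> m\<close>]) auto
    then have "0 \<le> 1 / \<epsilon>\<^sup>2 * (\<sigma> * (X * (t x)\<^sup>2) + m * (Y * (t x)\<^sup>2))"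
      by (intro mult_nonneg_nonneg) auto
    also have "\<dots> = \<sigma> * (1 / \<epsilon>\<^sup>2 * (X * (t x)\<^sup>2)) + m * (1 / \<epsilon>\<^sup>2 * (Y * (t x)\<^sup>2))"
      by (simp only: ring_distribs mult.left_commute)
    also have "\<dots> = \<sigma> * (lap_u x \<bullet> T (\<phi> x)) / q x + m * t x * (lap_u x \<bullet> N (\<phi> x))"
      unfolding X[symmetric] Y[symmetric] by simp
    finally show ?thesis .
  qed
  have small: "0 \<le> 1 - 2 * t x * (k (\<phi> x) / q x) +
      (\<sigma> * (t x * k' (\<phi> x) / q x) - m * t x * (k (\<phi> x) * q x)) * m * (t x)\<^sup>2"
    if \<sigma>: "\<sigma> * \<sigma> = 1" and x: "x \<in> \<omega>" for \<sigma> x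
  proof (rule gradient_term_nonneg[OF \<sigma> less_imp_le[OF \<open>m > 0\<close>] \<open>c\<^sub>2 > 0\<close> \<open>c\<^sub>3 > 0\<close> \<open>c\<^sub>4 > 0\<close>])
    have q: "q x > 0" using q_pos[OF t_le(1)[OF x], of "\<phi> x"] by (simp add: q_def)
    note le = t_le(1)[OF x]
    show "\<bar>t x\<bar> \<le> \<delta>\<^sub>1" using t_bound[of x] closure x by auto
    show "\<bar>k (\<phi> x) / q x\<bar> \<le> c\<^sub>4"
      using c4[OF le, of "\<phi> x"] q unfolding coeffs a q_def[symmetric]
      by (simp add: abs_mult power2_eq_square)
    show "\<bar>t x * k' (\<phi> x) / q x\<bar> \<le> c\<^sub>3 * \<bar>t x\<bar>"
      using c3[OF le, of "\<phi> x"] q unfolding coeffs a q_def[symmetric]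
      by (simp add: power2_eq_square)
    show "\<bar>k (\<phi> x) * q x\<bar> \<le> c\<^sub>2"
      using c2[OF le, of "\<phi> x"] unfolding coeffs q_def[symmetric] .
    show "2 * c\<^sub>4 * \<delta>\<^sub>1 + m * (m * c\<^sub>2 + c\<^sub>3) * \<delta>\<^sub>1 ^ 3 < 1" by fact
  qed
  have max: "\<exists>v. has_maximum_on (\<lambda>x. \<sigma> * \<phi> x + m * (t x)\<^sup>2 / 2) (closure \<omega>) v \<and>
      has_maximum_on (\<lambda>x. \<sigma> * \<phi> x + m * (t x)\<^sup>2 / 2) (frontier \<omega>) v"
    if \<sigma>: "\<sigma> * \<sigma> = 1" for \<sigma>
  proof (rule maximum_on_frontier[OF \<open>bounded \<omega>\<close> \<open>\<omega> \<noteq> {}\<close>])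
    show "continuous_on (closure \<omega>) (\<lambda>x. \<sigma> * \<phi> x + m * (t x)\<^sup>2 / 2)"
      using cont_coords by (intro continuous_intros) auto
    show "\<exists>y\<in>frontier \<omega>. \<sigma> * \<phi> x + m * (t x)\<^sup>2 / 2 \<le> \<sigma> * \<phi> y + m * (t y)\<^sup>2 / 2"
      if "x \<in> closure \<omega>" for x
      by (rule barrier_maximum_principle[OF \<open>bounded \<omega>\<close> cont_coords \<sigma> less_imp_le[OF \<open>m > 0\<close>]
            reaction[OF \<sigma>] small[OF \<sigma>] that])
  qed
  obtain v where "has_maximum_on (\<lambda>x. - (\<phi> x - m * (t x)\<^sup>2 / 2)) (closure \<omega>) v"
      "has_maximum_on (\<lambda>x. - (\<phi> x - m * (t x)\<^sup>2 / 2)) (frontier \<omega>) v"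
    using max[of "-1"] by auto
  then have "has_minimum_on (\<lambda>x. \<phi> x - m * (t x)\<^sup>2 / 2) (closure \<omega>) (- v)"
      "has_minimum_on (\<lambda>x. \<phi> x - m * (t x)\<^sup>2 / 2) (frontier \<omega>) (- v)"
    by (simp_all only: minimum_on_iff minus_minus)
  then have "\<exists>v. has_minimum_on (\<lambda>x. \<phi> x - m * (t x)\<^sup>2 / 2) (closure \<omega>) v \<and>
      has_minimum_on (\<lambda>x. \<phi> x - m * (t x)\<^sup>2 / 2) (frontier \<omega>) v"
    by blast
  moreover have "\<exists>v. has_maximum_on (\<lambda>x. \<phi> x + m * (t x)\<^sup>2 / 2) (closure \<omega>) v \<and>
      has_maximum_on (\<lambda>x. \<phi> x + m * (t x)\<^sup>2 / 2) (frontier \<omega>) v"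
    using max[of 1] by simp
  ultimately show ?thesis by blast
qed

end
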